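(* Let $G$ be a recurrent graph with bounded degree. Assign i.i.d. conductances to the edges of $G$. Then, almost surely, the resulting electrical network is recurrent.
   Context: $G$ is an infinite connected graph; it is recurrent if the simple random walk on it is recurrent. Conductances are nonnegative finite (random) numbers $C_e$, one for each edge $e$. An electrical network (graph with conductances) is recurrent if the random walk that moves from a vertex along incident edges with probabilities proportional to their conductances is recurrent; equivalently, if the effective conductance from any vertex to infinity is $0$. *)

theory Defs
  imports "HOL-Probability.Probability"
begin

text \<open>
  A graph is a vertex set \<open>V\<close> together with a set \<open>E\<close> of unordered pairs of distinct vertices
  (no loops, no multiple edges).
\<close>

definition simple_graph :: "'v set \<Rightarrow> 'v set set \<Rightarrow> bool" where
  "simple_graph V E \<longleftrightarrow> (\<forall>e\<in>E. \<exists>u\<in>V. \<exists>v\<in>V. u \<noteq> v \<and> e = {u, v})"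

definition connected_graph :: "'v set \<Rightarrow> 'v set set \<Rightarrow> bool" where
  "connected_graph V E \<longleftrightarrow> (\<forall>u\<in>V. \<forall>v\<in>V. (u, v) \<in> {(x, y). {x, y} \<in> E}\<^sup>*)"

definition incident :: "'v set set \<Rightarrow> 'v \<Rightarrow> 'v set set" where
  "incident E v = {e \<in> E. v \<in> e}"

definition bounded_degree :: "'v set \<Rightarrow> 'v set set \<Rightarrow> bool" where
  "bounded_degree V E \<longleftrightarrow> (\<exists>D::nat. \<forall>v\<in>V. finite (incident E v) \<and> card (incident E v) \<le> D)"

definition total_conductance :: "'v set set \<Rightarrow> ('v set \<Rightarrow> real) \<Rightarrow> 'v \<Rightarrow> real" where
  "total_conductance E c x = (\<Sum>e\<in>incident E x. c e)"

text \<open>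
  The transition law at \<open>x\<close> of the random walk on the network with conductances \<open>c\<close>.  It is
  meaningful when \<open>x\<close> has finite degree and \<open>c\<close> is nonnegative (lemma \<open>pmf_network_step\<close>).
  Conductances may vanish; if all of them vanish around \<open>x\<close>, the walk stays at \<open>x\<close>.
\<close>

definition network_step :: "'v set set \<Rightarrow> ('v set \<Rightarrow> real) \<Rightarrow> 'v \<Rightarrow> 'v pmf" where
  "network_step E c x =
     (if total_conductance E c x = 0 then return_pmf x
      else embed_pmf (\<lambda>y. if {x, y} \<in> E then c {x, y} / total_conductance E c x else 0))"

lemma pmf_network_step:
  assumes E: "simple_graph V E" and fin: "finite (incident E x)"
    and c: "\<And>e. e \<in> E \<Longrightarrow> 0 \<le> c e" and nz: "total_conductance E c x \<noteq> 0"
  shows "pmf (network_step E c x) y =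
           (if {x, y} \<in> E then c {x, y} / total_conductance E c x else 0)"
proof -
  let ?T = "total_conductance E c x"
  let ?f = "\<lambda>y. if {x, y} \<in> E then c {x, y} / ?T else 0"
  define N where "N = {y. {x, y} \<in> E}"
  have T: "0 \<le> ?T"
    unfolding total_conductance_def by (rule sum_nonneg) (auto simp: incident_def c)
  have inj: "inj_on (\<lambda>y. {x, y}) N"
    by (auto simp: inj_on_def doubleton_eq_iff)
  have img: "(\<lambda>y. {x, y}) ` N = incident E x"
  proof (intro equalityI subsetI)
    fix e assume e: "e \<in> incident E x"
    then obtain u v where "e = {u, v}"
      using E by (auto simp: simple_graph_def incident_def)
    with e show "e \<in> (\<lambda>y. {x, y}) ` N"
      by (auto simp: N_def incident_def insert_commute)
  qed (auto simp: N_def incident_def)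
  have finN: "finite N"
    using fin finite_imageD[OF _ inj] by (simp add: img)
  have sum1: "(\<Sum>y\<in>N. c {x, y} / ?T) = 1"
  proof -
    have "(\<Sum>y\<in>N. c {x, y}) = ?T"
      unfolding total_conductance_def img[symmetric] by (simp add: sum.reindex[OF inj])
    then show ?thesis
      using nz by (simp flip: sum_divide_distrib)
  qed
  have nonneg: "\<And>y. 0 \<le> ?f y"
    using T c by auto
  have "(\<integral>\<^sup>+y. ennreal (?f y) \<partial>count_space UNIV) = (\<integral>\<^sup>+y. ennreal (?f y) \<partial>count_space N)"
    by (rule nn_integral_count_space_eq) (auto simp: N_def)
  also have "\<dots> = (\<Sum>y\<in>N. ennreal (?f y))"
    by (rule nn_integral_count_space_finite[OF finN])
  also have "\<dots> = ennreal (\<Sum>y\<in>N. ?f y)"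
    by (rule sum_ennreal) (rule nonneg)
  also have "(\<Sum>y\<in>N. ?f y) = (\<Sum>y\<in>N. c {x, y} / ?T)"
    by (rule sum.cong) (auto simp: N_def)
  finally have "(\<integral>\<^sup>+y. ennreal (?f y) \<partial>count_space UNIV) = 1"
    by (simp add: sum1)
  with nonneg have "pmf (embed_pmf ?f) y = ?f y"
    by (intro pmf_embed_pmf)
  then show ?thesis
    using nz by (simp add: network_step_def)
qed

text \<open>
  The law, on trajectories \<open>nat \<Rightarrow> 'v\<close>, of the Markov chain with transition kernel \<open>K\<close> started at
  \<open>x\<close>: the projective limit given by the Ionescu-Tulcea theorem.  The coordinate process is the
  chain (lemma \<open>markov_law_prefix\<close>).
\<close>

definition markov_kernels :: "('v \<Rightarrow> 'v pmf) \<Rightarrow> 'v \<Rightarrow> nat \<Rightarrow> (nat \<Rightarrow> 'v) \<Rightarrow> 'v measure" where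
  "markov_kernels K x n \<omega> = measure_pmf (case n of 0 \<Rightarrow> return_pmf x | Suc m \<Rightarrow> K (\<omega> m))"

lemma Ionescu_Tulcea_markov_kernels:
  fixes K :: "'v \<Rightarrow> 'v pmf"
  shows "Ionescu_Tulcea (markov_kernels K x) (\<lambda>_. count_space UNIV)"
proof (rule Ionescu_Tulcea.intro)
  fix i
  show "markov_kernels K x i \<in>
          measurable (PiM {0..<i} (\<lambda>_. count_space UNIV)) (subprob_algebra (count_space UNIV))"
  proof (cases i)
    case 0
    then show ?thesis
      by (simp add: markov_kernels_def[abs_def] measure_pmf_in_subprob_algebra)
  next
    case (Suc m)
    have "(\<lambda>\<omega>. \<omega> m) \<in> measurable (PiM {0..<i} (\<lambda>_. count_space (UNIV :: 'v set))) (count_space UNIV)"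
      using Suc by (intro measurable_component_singleton) auto
    moreover have "(\<lambda>y. measure_pmf (K y)) \<in>
        measurable (count_space UNIV) (subprob_algebra (count_space UNIV))"
      by (simp add: measure_pmf_in_subprob_algebra)
    ultimately have "(\<lambda>\<omega>. measure_pmf (K (\<omega> m))) \<in>
        measurable (PiM {0..<i} (\<lambda>_. count_space UNIV)) (subprob_algebra (count_space UNIV))"
      by (rule measurable_compose)
    then show ?thesis
      by (simp only: Suc markov_kernels_def[abs_def] nat.case)
  qed
next
  fix i :: nat and \<omega> :: "nat \<Rightarrow> 'v"
  show "prob_space (markov_kernels K x i \<omega>)"
    unfolding markov_kernels_def by (rule measure_pmf.prob_space_axioms)
qed

global_interpretation markov: Ionescu_Tulcea "markov_kernels K x" "\<lambda>_. count_space UNIV"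
  for K :: "'v \<Rightarrow> 'v pmf" and x :: 'v
  by (rule Ionescu_Tulcea_markov_kernels)

definition markov_law :: "('v \<Rightarrow> 'v pmf) \<Rightarrow> 'v \<Rightarrow> (nat \<Rightarrow> 'v) measure" where
  "markov_law K x = markov.PF.lim K x"

lemma prob_space_markov_law: "prob_space (markov_law K x)"
proof
  let ?S = "\<lambda>_::nat. count_space (UNIV :: 'a set)"
  have sp: "space (PiM {} ?S) \<in> sets (PiM {} ?S)"
    by (rule sets.top)
  have "emeasure (markov.PF.lim K x) (prod_emb UNIV ?S {} (space (PiM {} ?S))) =
      emeasure (markov.CI K x {}) (space (PiM {} ?S))"
    by (rule markov.lim[OF _ sp]) simp
  also have "\<dots> = 1"
    using prob_space.emeasure_space_1[OF markov.PF.prob_space_P[of "{}" K x]]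
    by (simp add: markov.CI_def)
  also have "prod_emb UNIV ?S {} (space (PiM {} ?S)) = space (markov.PF.lim K x)"
    by (auto simp: prod_emb_def space_PiM)
  finally show "emeasure (markov_law K x) (space (markov_law K x)) = 1"
    by (simp add: markov_law_def)
qed

lemma sets_markov_law: "sets (markov_law K x) = sets (PiM UNIV (\<lambda>_. count_space UNIV))"
  by (simp add: markov_law_def)

lemma markov_law_prefix:
  "emeasure (markov_law K x) {\<omega>. \<forall>i\<le>n. \<omega> i = w i} =
     (if w 0 = x then \<Prod>i<n. ennreal (pmf (K (w i)) (w (Suc i))) else 0)"
proof -
  let ?S = "\<lambda>_::nat. count_space (UNIV :: 'a set)"
  let ?w = "\<lambda>n. restrict w {0..<n}"
  let ?C = "\<lambda>n. markov.C K x 0 n (\<lambda>_. undefined)"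
  have sing: "{?w n} \<in> sets (PiM {0..<n} ?S)" for n
  proof -
    have "PiE {0..<n} (\<lambda>i. {w i}) \<in> sets (PiM {0..<n} ?S)"
      by (rule sets_PiM_I_finite) auto
    also have "PiE {0..<n} (\<lambda>i. {w i}) = {?w n}"
      by (auto simp: PiE_iff extensional_def fun_eq_iff)
    finally show ?thesis .
  qed
  have C: "emeasure (?C n) {?w n} = (\<Prod>i<n. emeasure (markov_kernels K x i w) {w i})" for n
  proof (induction n)
    case 0
    show ?case
      using sing[of 0] by (simp add: restrict_def)
  next
    case (Suc n)
    have undef: "(\<lambda>_. undefined) \<in> space (PiM {0..<0} ?S)"
      by simp
    have spC: "space (?C n) = space (PiM {0..<n} ?S)"
      using markov.space_C[OF undef] by simp
    have setC: "sets (?C n) = sets (PiM {0..<n} ?S)"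
      using markov.sets_C[OF undef] by simp
    have meas: "markov.eP K x n \<in> measurable (?C n) (subprob_algebra (PiM {0..<Suc n} ?S))"
      unfolding measurable_cong_sets[OF setC refl] by (rule markov.measurable_eP)
    have ker: "emeasure (markov.eP K x n \<omega>) {?w (Suc n)} =
        emeasure (markov_kernels K x n w) {w n} * indicator {?w n} \<omega>" if "\<omega> \<in> space (?C n)" for \<omega>
    proof -
      have \<omega>: "\<omega> \<in> space (PiM {0..<n} ?S)"
        using that spC by simp
      then have ext: "\<omega> i = undefined" if "\<not> i < n" for i
        using that by (auto simp: space_PiM PiE_iff extensional_def)
      have upd: "fun_upd \<omega> n y = ?w (Suc n) \<longleftrightarrow> \<omega> = ?w n \<and> y = w n" for y
      proof
        assume eq: "fun_upd \<omega> n y = ?w (Suc n)"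
        have "\<omega> i = ?w n i" for i
          using fun_cong[OF eq, of i] ext[of i] by (cases "i < n") auto
        then show "\<omega> = ?w n \<and> y = w n"
          using fun_cong[OF eq, of n] by auto
      next
        assume "\<omega> = ?w n \<and> y = w n"
        then show "fun_upd \<omega> n y = ?w (Suc n)"
          by (auto simp: fun_eq_iff)
      qed
      have "emeasure (markov.eP K x n \<omega>) {?w (Suc n)} =
          emeasure (markov_kernels K x n \<omega>) {y. fun_upd \<omega> n y = ?w (Suc n)}"
        by (subst markov.emeasure_eP[OF \<omega> sing]) (simp add: vimage_def)
      also have "\<dots> = emeasure (markov_kernels K x n w) {w n} * indicator {?w n} \<omega>"
      proof (cases "\<omega> = ?w n")
        case True
        have "markov_kernels K x n \<omega> = markov_kernels K x n w"
          unfolding True by (auto simp: markov_kernels_def split: nat.split)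
        then show ?thesis
          unfolding upd using True by simp
      next
        case False
        then show ?thesis
          unfolding upd by simp
      qed
      finally show ?thesis .
    qed
    have "emeasure (?C (Suc n)) {?w (Suc n)} =
        (\<integral>\<^sup>+\<omega>. emeasure (markov.eP K x n \<omega>) {?w (Suc n)} \<partial>?C n)"
      using emeasure_bind[OF _ meas sing] markov.prob_space_C[OF undef, THEN prob_space.not_empty]
      by simp
    also have "\<dots> = (\<integral>\<^sup>+\<omega>. emeasure (markov_kernels K x n w) {w n} * indicator {?w n} \<omega> \<partial>?C n)"
      by (rule nn_integral_cong) (rule ker)
    also have "\<dots> = emeasure (markov_kernels K x n w) {w n} * emeasure (?C n) {?w n}"
      by (rule nn_integral_cmult_indicator) (simp add: setC sing)
    finally show ?case
      by (simp only: Suc.IH prod.lessThan_Suc mult.commute)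
  qed
  have "{\<omega>. \<forall>i\<le>n. \<omega> i = w i} = prod_emb UNIV ?S {0..<Suc n} {?w (Suc n)}"
  proof -
    have "(\<forall>i\<le>n. \<omega> i = w i) \<longleftrightarrow> restrict \<omega> {0..<Suc n} = ?w (Suc n)" for \<omega>
      by (auto simp: fun_eq_iff restrict_def less_Suc_eq_le)
    then show ?thesis
      by (auto simp: prod_emb_def space_PiM)
  qed
  then have "emeasure (markov_law K x) {\<omega>. \<forall>i\<le>n. \<omega> i = w i} =
      emeasure (markov.CI K x {0..<Suc n}) {?w (Suc n)}"
    using markov.lim[OF _ sing] by (simp add: markov_law_def)
  also have "\<dots> = emeasure (?C (Suc n)) {?w (Suc n)}"
    using markov.emeasure_CI[OF order_refl sing[of "Suc n"], of K x]
    by (simp only: prod_emb_id[OF sets.sets_into_space[OF sing, unfolded space_PiM]])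
  also have "\<dots> = (\<Prod>i<Suc n. emeasure (markov_kernels K x i w) {w i})"
    by (rule C)
  also have "\<dots> = (if w 0 = x then \<Prod>i<n. ennreal (pmf (K (w i)) (w (Suc i))) else 0)"
    by (simp add: prod.lessThan_Suc_shift markov_kernels_def emeasure_pmf_single indicator_def
             del: prod.lessThan_Suc)
  finally show ?thesis .
qed

text \<open>
  Return is required from every starting vertex: vanishing conductances may disconnect the network.
\<close>

definition recurrent_network :: "'v set \<Rightarrow> 'v set set \<Rightarrow> ('v set \<Rightarrow> real) \<Rightarrow> bool" where
  "recurrent_network V E c \<longleftrightarrow>
     (\<forall>x\<in>V. AE \<omega> in markov_law (network_step E c) x. \<exists>n\<ge>1. \<omega> n = x)"

definition recurrent_graph :: "'v set \<Rightarrow> 'v set set \<Rightarrow> bool" where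
  "recurrent_graph V E \<longleftrightarrow> recurrent_network V E (\<lambda>_. 1)"

end

theory Submission
  imports Defs "HOL-Library.Transitive_Closure_Table" "HOL-Real_Asymp.Real_Asymp"
begin

text \<open>
  A network is recurrent at \<open>a\<close> iff there are finitely supported functions \<open>g\<close> with \<open>g a \<ge> 1\<close> and
  arbitrarily small Dirichlet energy; for the graph itself, the probability \<open>f\<close> of hitting \<open>a\<close>
  within \<open>n\<close> steps is such a function.  Choose \<open>L\<close> so large that the edges with conductance above
  \<open>L\<close> form a subcritical percolation: by bounded degree its clusters are finite, and open paths of
  length \<open>n\<close> are exponentially unlikely.  Replace \<open>f\<close> by its maximum \<open>g\<close> over the cluster.  Then \<open>g\<close>
  does not vary along edges of large conductance, and the increment of \<open>g\<close> along any other edge is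
  bounded, by Cauchy-Schwarz, by the increments of \<open>f\<close> along an open path.  Hence the expected unit
  conductance energy of \<open>g\<close> is at most a constant times the energy of \<open>f\<close>, so almost surely the
  energy of \<open>g\<close> with the random conductances (at most \<open>L\<close> wherever \<open>g\<close> varies) gets arbitrarily small.
\<close>

subsection \<open>Return probabilities of a Markov chain\<close>

text \<open>The probability that the chain started at \<open>x\<close> stays off \<open>a\<close> at
  the times 1 to \<open>n\<close>. Time 0 does not count, so for \<open>x = a\<close> this is the
  probability of no return.\<close>

primrec avoid :: "('v \<Rightarrow> 'v pmf) \<Rightarrow> 'v \<Rightarrow> nat \<Rightarrow> 'v \<Rightarrow> real" where
  "avoid K a 0 x = 1"
| "avoid K a (Suc n) x = measure_pmf.expectation (K x) (\<lambda>y. if y = a then 0 else avoid K a n y)"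

lemma avoid_bounds: "0 \<le> avoid K a n x \<and> avoid K a n x \<le> 1"
proof (induction n arbitrary: x)
  case (Suc n)
  have "avoid K a (Suc n) x \<le> measure_pmf.expectation (K x) (\<lambda>_. 1)"
    unfolding avoid.simps using Suc
    by (intro integral_mono measure_pmf.integrable_const_bound[where B = 1]) auto
  then show ?case
    using Suc by (auto intro!: integral_nonneg_AE)
qed simp

lemma avoid_nonneg: "0 \<le> avoid K a n x" and avoid_le_1: "avoid K a n x \<le> 1"
  using avoid_bounds by metis+

lemma integrable_avoid: "integrable (measure_pmf p) (\<lambda>y. if y = a then 0 else avoid K a n y)"
  by (intro measure_pmf.integrable_const_bound[where B = 1]) (auto simp: avoid_bounds)

lemma avoid_Suc_le: "avoid K a (Suc n) x \<le> avoid K a n x"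
proof (induction n arbitrary: x)
  case 0
  show ?case using avoid_le_1[of K a "Suc 0" x] by simp
next
  case (Suc n)
  show ?case
    unfolding avoid.simps(2)[of K a "Suc n" x] avoid.simps(2)[of K a n x]
    by (intro integral_mono integrable_avoid) (use Suc in \<open>simp del: avoid.simps\<close>)
qed

lemma ennreal_avoid_Suc:
  "ennreal (avoid K a (Suc n) x) = (\<integral>\<^sup>+y. ennreal (if y = a then 0 else avoid K a n y) \<partial>measure_pmf (K x))"
  unfolding avoid.simps
  by (rule nn_integral_eq_integral[symmetric, OF integrable_avoid]) (auto simp: avoid_nonneg)

section \<open>Avoidance probabilities as probabilities of trajectory events\<close>

lemma space_markov_law [simp]: "space (markov_law K x) = UNIV"
  using sets_eq_imp_space_eq[OF sets_markov_law[of K x]] by (auto simp: space_PiM)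

lemma measurable_markov_law [measurable]:
  "(\<lambda>\<omega>. \<omega> i) \<in> measurable (markov_law K x) (count_space UNIV)"
  unfolding measurable_cong_sets[OF sets_markov_law refl] by simp

lemma sets_markov_lawI:
  "Measurable.pred (markov_law K x) P \<Longrightarrow> {\<omega>. P \<omega>} \<in> sets (markov_law K x)"
  by (drule predE) simp

lemma markov_law_prefix_Suc:
  "emeasure (markov_law K x) {\<omega>. \<forall>i\<le>Suc j. \<omega> i = (w(Suc j := y)) i} =
     emeasure (markov_law K x) {\<omega>. \<forall>i\<le>j. \<omega> i = w i} * ennreal (pmf (K (w j)) y)"
  unfolding markov_law_prefix by (simp add: prod.lessThan_Suc)

text \<open>The extensions of the prefix by points of the support already carry its whole mass. As
  the support of a \<open>pmf\<close> is countable, events can then be split over the next state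
  even when the state space is uncountable.\<close>

lemma AE_markov_law_step:
  "AE \<omega> in markov_law K x. (\<forall>i\<le>j. \<omega> i = w i) \<longrightarrow> \<omega> (Suc j) \<in> set_pmf (K (w j))"
proof -
  let ?M = "markov_law K x"
  let ?S = "set_pmf (K (w j))"
  let ?P = "{\<omega>. \<forall>i\<le>j. \<omega> i = w i}"
  let ?A = "\<lambda>y. {\<omega>. \<forall>i\<le>Suc j. \<omega> i = (w(Suc j := y)) i}"
  have A [measurable]: "?A y \<in> sets ?M" for y
    by (rule sets_markov_lawI) measurable
  have P [measurable]: "?P \<in> sets ?M"
    by (rule sets_markov_lawI) measurable
  have fin: "emeasure ?M ?P \<noteq> \<infinity>"
    using finite_measure.emeasure_finite[OF prob_space.finite_measure[OF prob_space_markov_law]]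
    by simp
  have U: "(\<Union>y\<in>?S. ?A y) = {\<omega>\<in>?P. \<omega> (Suc j) \<in> ?S}"
    by (fastforce simp: le_Suc_eq)
  have Us: "(\<Union>y\<in>?S. ?A y) \<in> sets ?M"
    by (intro sets.countable_UN'' countable_set_pmf A)
  have "emeasure ?M (\<Union>y\<in>?S. ?A y) = (\<integral>\<^sup>+y. emeasure ?M (?A y) \<partial>count_space ?S)"
    by (intro emeasure_UN_countable A countable_set_pmf)
       (auto simp: disjoint_family_on_def dest: spec[of _ "Suc j"])
  also have "\<dots> = (\<integral>\<^sup>+y. emeasure ?M ?P * ennreal (pmf (K (w j)) y) \<partial>count_space ?S)"
    by (simp only: markov_law_prefix_Suc)
  also have "\<dots> = emeasure ?M ?P * (\<integral>\<^sup>+y. ennreal (pmf (K (w j)) y) \<partial>count_space ?S)"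
    by (rule nn_integral_cmult) simp
  also have "(\<integral>\<^sup>+y. ennreal (pmf (K (w j)) y) \<partial>count_space ?S) = 1"
    by (simp add: nn_integral_pmf emeasure_pmf_UNIV measure_pmf.emeasure_eq_measure
        measure_pmf.prob_eq_1 AE_measure_pmf)
  finally have "emeasure ?M (?P - (\<Union>y\<in>?S. ?A y)) = 0"
    using fin by (subst emeasure_Diff[OF _ P Us]) (auto simp: U Us)
  moreover have "?P - (\<Union>y\<in>?S. ?A y) \<in> sets ?M"
    using P Us by auto
  ultimately have "AE \<omega> in ?M. \<omega> \<notin> ?P - (\<Union>y\<in>?S. ?A y)"
    by (intro AE_not_in) (auto simp: null_sets_def)
  then show ?thesis
    by eventually_elim (use U in blast)
qed

text \<open>The Markov property at time \<open>j\<close>. In the induction the state at time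
  \<open>Suc j\<close> is moved into the prefix, and summing over it reproduces the recursion of
  \<open>avoid\<close>.\<close>

lemma emeasure_markov_avoid:
  "emeasure (markov_law K x) {\<omega>. (\<forall>i\<le>j. \<omega> i = w i) \<and> (\<forall>i. j < i \<and> i \<le> j + n \<longrightarrow> \<omega> i \<noteq> a)} =
     emeasure (markov_law K x) {\<omega>. \<forall>i\<le>j. \<omega> i = w i} * ennreal (avoid K a n (w j))"
proof (induction n arbitrary: j w)
  case 0
  show ?case by (simp add: not_le[symmetric])
next
  case (Suc n)
  let ?M = "markov_law K x"
  let ?S = "set_pmf (K (w j))"
  let ?E = "\<lambda>j n w. {\<omega>. (\<forall>i\<le>j. \<omega> i = w i) \<and> (\<forall>i. j < i \<and> i \<le> j + n \<longrightarrow> \<omega> i \<noteq> a)}"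
  let ?w = "\<lambda>y. w(Suc j := y)"
  let ?p = "emeasure ?M {\<omega>. \<forall>i\<le>j. \<omega> i = w i}"
  have E [measurable]: "?E j n w \<in> sets ?M" for j n w
    by (rule sets_markov_lawI) measurable
  have Us: "(\<Union>y\<in>?S - {a}. ?E (Suc j) n (?w y)) \<in> sets ?M"
    by (intro sets.countable_UN'' countable_Diff countable_set_pmf E)
  have split: "(\<forall>i. j < i \<and> i \<le> j + Suc n \<longrightarrow> \<omega> i \<noteq> a) \<longleftrightarrow>
      \<omega> (Suc j) \<noteq> a \<and> (\<forall>i. Suc j < i \<and> i \<le> Suc j + n \<longrightarrow> \<omega> i \<noteq> a)" for \<omega> :: "nat \<Rightarrow> 'a"
  proof -
    have "j < i \<and> i \<le> j + Suc n \<longleftrightarrow> i = Suc j \<or> (Suc j < i \<and> i \<le> Suc j + n)" for i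
      by auto
    then show ?thesis by auto
  qed
  have "emeasure ?M (?E j (Suc n) w) = emeasure ?M (\<Union>y\<in>?S - {a}. ?E (Suc j) n (?w y))"
  proof (rule emeasure_eq_AE[OF _ E Us])
    show "AE \<omega> in ?M. \<omega> \<in> ?E j (Suc n) w \<longleftrightarrow> \<omega> \<in> (\<Union>y\<in>?S - {a}. ?E (Suc j) n (?w y))"
      using AE_markov_law_step[where K = K and x = x and j = j and w = w]
      by eventually_elim (auto simp: split le_Suc_eq simp del: add_Suc_right)
  qed
  also have "\<dots> = (\<integral>\<^sup>+y. emeasure ?M (?E (Suc j) n (?w y)) \<partial>count_space (?S - {a}))"
    by (intro emeasure_UN_countable E countable_Diff countable_set_pmf)
       (auto simp: disjoint_family_on_def dest: spec[of _ "Suc j"])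
  also have "\<dots> = (\<integral>\<^sup>+y. ?p * (ennreal (pmf (K (w j)) y) * ennreal (avoid K a n y)) \<partial>count_space (?S - {a}))"
    unfolding Suc.IH markov_law_prefix_Suc by (simp add: mult.assoc)
  also have "\<dots> = (\<integral>\<^sup>+y. ?p * (ennreal (pmf (K (w j)) y) *
      ennreal (if y = a then 0 else avoid K a n y)) \<partial>count_space (?S - {a}))"
    by (rule nn_integral_cong) auto
  \<comment> \<open>The added points contribute 0: off the support the \<open>pmf\<close> vanishes,
    and at \<open>a\<close> the other factor does.\<close>
  also have "\<dots> = (\<integral>\<^sup>+y. ?p * (ennreal (pmf (K (w j)) y) *
      ennreal (if y = a then 0 else avoid K a n y)) \<partial>count_space UNIV)"
    by (rule nn_integral_count_space_eq) (auto simp: set_pmf_iff)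
  also have "\<dots> = ?p * ennreal (avoid K a (Suc n) (w j))"
    unfolding ennreal_avoid_Suc nn_integral_measure_pmf by (rule nn_integral_cmult) simp
  finally show ?case .
qed

text \<open>The events of no return up to time \<open>n\<close> decrease to the event of no return
  at all. This is the link between recurrence, stated for trajectories, and the recursion of
  \<open>avoid\<close>.\<close>

lemma AE_return_iff_avoid:
  "(AE \<omega> in markov_law K x. \<exists>n\<ge>1. \<omega> n = x) \<longleftrightarrow> (\<lambda>n. avoid K x n x) \<longlonglongrightarrow> 0"
proof -
  let ?M = "markov_law K x"
  interpret prob_space ?M by (rule prob_space_markov_law)
  \<comment> \<open>Requiring \<open>\<omega> 0 = x\<close>, which has probability 1, turns this
    into the event of \<open>emeasure_markov_avoid\<close> with \<open>j = 0\<close>.\<close>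
  let ?N = "\<lambda>n::nat. {\<omega>::nat \<Rightarrow> 'a. \<omega> 0 = x \<and> (\<forall>i. 0 < i \<and> i \<le> n \<longrightarrow> \<omega> i \<noteq> x)}"
  have N: "?N n \<in> sets ?M" for n
    by (rule sets_markov_lawI) measurable
  have start: "emeasure ?M {\<omega>. \<omega> 0 = x} = 1"
    using markov_law_prefix[of K x 0 "\<lambda>_. x"] by simp
  then have "AE \<omega> in ?M. \<omega> \<in> {\<omega>. \<omega> 0 = x}"
    by (subst AE_in_set_eq_1) (auto simp: emeasure_eq_measure intro!: sets_markov_lawI)
  then have AE0: "AE \<omega> in ?M. \<omega> 0 = x" by simp
  have "emeasure ?M (?N n) = ennreal (avoid K x n x)" for n
    using emeasure_markov_avoid[of K x 0 "\<lambda>_. x" n x] start by simp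
  then have N_eq: "prob (?N n) = avoid K x n x" for n
    by (simp add: emeasure_eq_measure avoid_nonneg)
  have "(\<lambda>n. prob (?N n)) \<longlonglongrightarrow> prob (\<Inter>n. ?N n)"
    by (rule finite_Lim_measure_decseq) (use N in \<open>auto simp: decseq_def\<close>)
  then have lim: "(\<lambda>n. avoid K x n x) \<longlonglongrightarrow> prob (\<Inter>n. ?N n)"
    by (simp add: N_eq)
  have INT: "\<omega> \<in> (\<Inter>n. ?N n) \<longleftrightarrow> \<omega> 0 = x \<and> \<not> (\<exists>n\<ge>1. \<omega> n = x)" for \<omega> :: "nat \<Rightarrow> 'a"
  proof -
    have "(\<forall>m i::nat. 0 < i \<and> i \<le> m \<longrightarrow> \<omega> i \<noteq> x) \<longleftrightarrow> \<not> (\<exists>n\<ge>1. \<omega> n = x)"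
      unfolding One_nat_def Suc_le_eq by (blast intro: order_refl)
    then show ?thesis by blast
  qed
  have "(AE \<omega> in ?M. \<exists>n\<ge>1. \<omega> n = x) \<longleftrightarrow> (AE \<omega> in ?M. \<omega> \<notin> (\<Inter>n. ?N n))"
    by (rule eventually_subst) (use AE0 in \<open>eventually_elim, unfold INT, blast\<close>)
  also have "\<dots> \<longleftrightarrow> prob (\<Inter>n. ?N n) = 0"
  proof -
    have "(\<Inter>n. ?N n) \<in> sets ?M"
      using N sets.top[of ?M] by (intro sets.countable_INT'') auto
    then show ?thesis
      by (subst AE_iff_measurable[of "\<Inter>n. ?N n"]) (auto simp: emeasure_eq_measure)
  qed
  also have "\<dots> \<longleftrightarrow> (\<lambda>n. avoid K x n x) \<longlonglongrightarrow> 0"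
  proof
    show "prob (\<Inter>n. ?N n) = 0 \<Longrightarrow> (\<lambda>n. avoid K x n x) \<longlonglongrightarrow> 0"
      using lim by (simp only:)
  qed (rule LIMSEQ_unique[OF lim])
  finally show ?thesis .
qed

subsection \<open>Dirichlet energy and recurrence\<close>

definition nbrs :: "'v set set \<Rightarrow> 'v \<Rightarrow> 'v set" where
  "nbrs E x = {y. {x, y} \<in> E}"

definition arcs_on :: "'v set set \<Rightarrow> 'v set \<Rightarrow> ('v \<times> 'v) set" where
  "arcs_on E F = {(x, y). {x, y} \<in> E \<and> (x \<in> F \<or> y \<in> F)}"

text \<open>
  Every edge is counted in both directions, so this is twice the usual Dirichlet form when \<open>F\<close>
  contains the supports of the two functions.
\<close>

definition dirichlet :: "'v set set \<Rightarrow> ('v set \<Rightarrow> real) \<Rightarrow> 'v set \<Rightarrow> ('v \<Rightarrow> real) \<Rightarrow> ('v \<Rightarrow> real) \<Rightarrow> real" where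
  "dirichlet E c F f g = (\<Sum>(x, y)\<in>arcs_on E F. c {x, y} * (f x - f y) * (g x - g y))"

locale locally_finite_graph =
  fixes V :: "'v set" and E :: "'v set set"
  assumes graph: "simple_graph V E"
    and finite_incident_V: "x \<in> V \<Longrightarrow> finite (incident E x)"
begin

lemma edge_vertices: "{x, y} \<in> E \<Longrightarrow> x \<in> V \<and> y \<in> V \<and> x \<noteq> y"
  using graph by (fastforce simp: simple_graph_def doubleton_eq_iff)

lemma bij_betw_nbrs_incident: "bij_betw (\<lambda>y. {x, y}) (nbrs E x) (incident E x)"
proof (rule bij_betwI')
  fix e assume "e \<in> incident E x"
  then show "\<exists>y\<in>nbrs E x. e = {x, y}"
    using graph by (fastforce simp: simple_graph_def incident_def nbrs_def insert_commute)
qed (auto simp: doubleton_eq_iff nbrs_def incident_def)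

lemma finite_incident: "finite (incident E x)"
proof (cases "x \<in> V")
  case False
  then have "nbrs E x = {}"
    using edge_vertices by (auto simp: nbrs_def)
  then show ?thesis
    using bij_betw_nbrs_incident[of x] by (simp add: bij_betw_def)
qed (rule finite_incident_V)

lemma finite_nbrs: "finite (nbrs E x)"
  using bij_betw_finite[OF bij_betw_nbrs_incident] finite_incident by blast

lemma card_nbrs: "card (nbrs E x) = card (incident E x)"
  by (rule bij_betw_same_card[OF bij_betw_nbrs_incident])

lemma nbrs_sym: "y \<in> nbrs E x \<longleftrightarrow> x \<in> nbrs E y"
  by (simp add: nbrs_def insert_commute)

lemma nbrs_subset: "nbrs E x \<subseteq> V"
  using edge_vertices by (auto simp: nbrs_def)

lemma finite_arcs_on:
  assumes "finite F"
  shows "finite (arcs_on E F)"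
proof (rule finite_subset)
  let ?A = "Sigma F (nbrs E)"
  show "arcs_on E F \<subseteq> ?A \<union> prod.swap ` ?A"
    by (force simp: arcs_on_def nbrs_def insert_commute image_iff)
  show "finite (?A \<union> prod.swap ` ?A)"
    using assms finite_nbrs by auto
qed

lemma arcs_on_swap: "bij_betw prod.swap (arcs_on E F) (arcs_on E F)"
  by (rule bij_betw_byWitness[where f' = prod.swap]) (auto simp: arcs_on_def insert_commute)

text \<open>Summation by parts: reversing the arcs maps the terms with \<open>g y\<close> to the
  negatives of those with \<open>g x\<close>, hence the factor 2.\<close>

lemma dirichlet_green:
  assumes F: "finite F" and g: "\<And>x. x \<notin> F \<Longrightarrow> g x = 0"
  shows "dirichlet E c F f g = 2 * (\<Sum>x\<in>F. g x * (\<Sum>y\<in>nbrs E x. c {x, y} * (f x - f y)))"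
proof -
  have gF: "g x \<noteq> 0 \<Longrightarrow> x \<in> F" for x
    using g by blast
  let ?T = "arcs_on E F"
  let ?a = "\<lambda>x y. c {x, y} * (f x - f y)"
  have T: "finite ?T"
    by (rule finite_arcs_on[OF F])
  have "dirichlet E c F f g = (\<Sum>(x, y)\<in>?T. ?a x y * g x) - (\<Sum>(x, y)\<in>?T. ?a x y * g y)"
    unfolding dirichlet_def sum_subtractf[symmetric] by (rule sum.cong) (auto simp: algebra_simps)
  also have "(\<Sum>(x, y)\<in>?T. ?a x y * g y) = (\<Sum>p\<in>?T. case prod.swap p of (x, y) \<Rightarrow> ?a x y * g y)"
    by (rule sum.reindex_bij_betw[OF arcs_on_swap, symmetric])
  also have "\<dots> = - (\<Sum>(x, y)\<in>?T. ?a x y * g x)"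
    unfolding sum_negf[symmetric] by (rule sum.cong) (auto simp: insert_commute algebra_simps)
  also have "(\<Sum>(x, y)\<in>?T. ?a x y * g x) = (\<Sum>(x, y)\<in>Sigma F (nbrs E). ?a x y * g x)"
    by (rule sum.mono_neutral_right[OF T]) (use gF in \<open>auto simp: arcs_on_def nbrs_def\<close>)
  also have "\<dots> = (\<Sum>x\<in>F. \<Sum>y\<in>nbrs E x. ?a x y * g x)"
    using F finite_nbrs by (subst sum.Sigma) auto
  also have "\<dots> = (\<Sum>x\<in>F. g x * (\<Sum>y\<in>nbrs E x. ?a x y))"
    by (simp add: sum_distrib_left mult_ac)
  finally show ?thesis by simp
qed

text \<open>Lets energies of functions with different supports be taken over one common set, so that
  Cauchy-Schwarz applies.\<close>

lemma dirichlet_superset: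
  assumes "finite F'" "F \<subseteq> F'" and g: "\<And>x. x \<notin> F \<Longrightarrow> g x = 0"
  shows "dirichlet E c F' f g = dirichlet E c F f g"
proof -
  have gF: "g x \<noteq> 0 \<Longrightarrow> x \<in> F" for x
    using g by blast
  show ?thesis
    unfolding dirichlet_def
    by (rule sum.mono_neutral_right[OF finite_arcs_on[OF assms(1)]])
       (use assms(2) g gF in \<open>auto simp: arcs_on_def\<close>)
qed

end

section \<open>Hitting probabilities on a network and the energy criterion for recurrence\<close>

locale electrical_network = locally_finite_graph V E for V :: "'v set" and E +
  fixes c :: "'v set \<Rightarrow> real"
  assumes c_nonneg: "e \<in> E \<Longrightarrow> 0 \<le> c e"
begin

abbreviation step where "step \<equiv> network_step E c"
abbreviation total where "total \<equiv> total_conductance E c"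

text \<open>Here time 0 counts as a visit, which \<open>avoid\<close> ignores; hence the separate
  case \<open>x = a\<close>.\<close>

definition hit :: "'v \<Rightarrow> nat \<Rightarrow> 'v \<Rightarrow> real" where
  "hit a n x = (if x = a then 1 else 1 - avoid step a n x)"

lemma total_eq: "total x = (\<Sum>y\<in>nbrs E x. c {x, y})"
  unfolding total_conductance_def by (rule sum.reindex_bij_betw[OF bij_betw_nbrs_incident, symmetric])

lemma total_nonneg: "0 \<le> total x"
  unfolding total_eq by (rule sum_nonneg) (auto simp: nbrs_def c_nonneg)

lemma pmf_step: "total x \<noteq> 0 \<Longrightarrow> pmf (step x) y = (if y \<in> nbrs E x then c {x, y} / total x else 0)"
  using pmf_network_step[OF graph finite_incident c_nonneg] by (simp add: nbrs_def)

lemma set_pmf_step: "set_pmf (step x) \<subseteq> insert x (nbrs E x)"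
proof (cases "total x = 0")
  case True
  then show ?thesis by (auto simp: network_step_def)
next
  case False
  then show ?thesis by (auto simp: set_pmf_iff pmf_step split: if_splits)
qed

text \<open>With the denominator cleared, the recursion also holds where the total conductance is 0:
  all conductances at \<open>x\<close> are then 0 and both sides vanish.\<close>

lemma total_times_avoid:
  "total x * avoid step a (Suc n) x =
     (\<Sum>y\<in>nbrs E x. c {x, y} * (if y = a then 0 else avoid step a n y))"
proof (cases "total x = 0")
  case True
  then have "\<forall>y\<in>nbrs E x. c {x, y} = 0"
    unfolding total_eq
    by (subst (asm) sum_nonneg_eq_0_iff[OF finite_nbrs]) (auto simp: nbrs_def c_nonneg)
  then show ?thesis
    using True by simp
next
  case False
  have "avoid step a (Suc n) x =
      (\<Sum>y\<in>nbrs E x. pmf (step x) y *\<^sub>R (if y = a then 0 else avoid step a n y))"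
    unfolding avoid.simps using False
    by (intro integral_measure_pmf finite_nbrs) (auto simp: set_pmf_iff pmf_step split: if_splits)
  then show ?thesis
    using False by (auto simp: pmf_step sum_distrib_left intro!: sum.cong)
qed

text \<open>The discrete Laplacian of \<open>hit\<close>. Off \<open>a\<close> it is
  \<open>total x\<close> times the change of \<open>avoid\<close> in one more step, which is
  nonpositive and tends to 0; at \<open>a\<close> only the probability of no return remains.\<close>

lemma laplacian_hit:
  "(\<Sum>y\<in>nbrs E x. c {x, y} * (hit a n x - hit a n y)) =
     total x * (avoid step a (Suc n) x - (if x = a then 0 else avoid step a n x))"
proof -
  let ?b = "\<lambda>x. if x = a then 0 else avoid step a n x"
  have "(\<Sum>y\<in>nbrs E x. c {x, y} * (hit a n x - hit a n y)) =
      (\<Sum>y\<in>nbrs E x. c {x, y} * ?b y - c {x, y} * ?b x)"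
    by (rule sum.cong) (auto simp: hit_def algebra_simps)
  also have "\<dots> = total x * avoid step a (Suc n) x - total x * ?b x"
    unfolding total_times_avoid by (simp only: sum_subtractf total_eq sum_distrib_right)
  finally show ?thesis
    by (simp only: right_diff_distrib)
qed

lemma hit_nonneg: "0 \<le> hit a n x"
  by (simp add: hit_def avoid_le_1)

text \<open>One more step enlarges the support at most by the neighbours of its points and by
  \<open>a\<close>, and all degrees are finite.\<close>

lemma finite_support_hit: "finite {x. hit a n x \<noteq> 0}"
proof (induction n)
  case 0
  have "{x. hit a 0 x \<noteq> 0} \<subseteq> {a}"
    by (auto simp: hit_def)
  then show ?case
    by (rule finite_subset) simp
next
  case (Suc n)
  let ?S = "\<lambda>n. {x. hit a n x \<noteq> 0}"
  have "?S (Suc n) \<subseteq> insert a (?S n \<union> (\<Union>y\<in>?S n. nbrs E y))"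
  proof
    fix x assume "x \<in> ?S (Suc n)"
    then have x: "x = a \<or> avoid step a (Suc n) x \<noteq> 1"
      by (auto simp: hit_def)
    have "avoid step a (Suc n) x = 1" if "\<And>y. y \<in> set_pmf (step x) \<Longrightarrow> hit a n y = 0"
    proof -
      have "avoid step a (Suc n) x = measure_pmf.expectation (step x) (\<lambda>_. 1)"
        unfolding avoid.simps
      proof (intro integral_cong_AE)
        show "AE y in step x. (if y = a then 0 else avoid step a n y) = 1"
          using that by (fastforce simp: AE_measure_pmf_iff hit_def split: if_splits)
      qed auto
      then show ?thesis by simp
    qed
    with x obtain y where "x = a \<or> y \<in> set_pmf (step x) \<and> hit a n y \<noteq> 0"
      by blast
    then show "x \<in> insert a (?S n \<union> (\<Union>y\<in>?S n. nbrs E y))"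
      using set_pmf_step[of x] nbrs_sym by auto
  qed
  then show ?case
    by (rule finite_subset) (use Suc finite_nbrs in auto)
qed

text \<open>\<open>hit a n\<close> is subharmonic away from \<open>a\<close>.\<close>

lemma dirichlet_hit_le:
  assumes F: "finite F" "{x. hit a n x \<noteq> 0} \<subseteq> F"
  shows "dirichlet E c F (hit a n) (hit a n) \<le> 2 * (total a * avoid step a (Suc n) a)"
proof -
  let ?t = "\<lambda>x. hit a n x * (total x * (avoid step a (Suc n) x - (if x = a then 0 else avoid step a n x)))"
  have a: "a \<in> F"
    using F by (auto simp: hit_def)
  have "(\<Sum>x\<in>F. ?t x) = ?t a + (\<Sum>x\<in>F - {a}. ?t x)"
    by (rule sum.remove[OF F(1) a])
  also have "(\<Sum>x\<in>F - {a}. ?t x) \<le> 0"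
    by (intro sum_nonpos mult_nonneg_nonpos hit_nonneg total_nonneg)
       (use avoid_Suc_le[of step a n] in auto)
  finally have "(\<Sum>x\<in>F. ?t x) \<le> total a * avoid step a (Suc n) a"
    by (simp add: hit_def)
  moreover have "dirichlet E c F (hit a n) (hit a n) = 2 * (\<Sum>x\<in>F. ?t x)"
    using F by (subst dirichlet_green) (auto simp only: laplacian_hit)
  ultimately show ?thesis by linarith
qed

lemma dirichlet_nonneg: "0 \<le> dirichlet E c F g g"
  unfolding dirichlet_def by (rule sum_nonneg) (auto simp: arcs_on_def c_nonneg mult.assoc)

lemma dirichlet_Cauchy_Schwarz:
  "(dirichlet E c F f g)\<^sup>2 \<le> dirichlet E c F f f * dirichlet E c F g g"
proof -
  let ?d = "\<lambda>f p. sqrt (c {fst p, snd p}) * (f (fst p) - f (snd p))"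
  have eq: "dirichlet E c F f g = (\<Sum>p\<in>arcs_on E F. ?d f p * ?d g p)" for f g
    unfolding dirichlet_def
  proof (rule sum.cong, goal_cases)
    case (2 p)
    then have "sqrt (c {fst p, snd p}) * sqrt (c {fst p, snd p}) = c {fst p, snd p}"
      using c_nonneg by (auto simp: arcs_on_def)
    then show ?case
      by (simp add: case_prod_beta mult_ac)
  qed simp
  show ?thesis
    using Cauchy_Schwarz_ineq_sum[of "?d f" "?d g" "arcs_on E F"]
    by (simp only: eq power2_eq_square)
qed

text \<open>Let \<open>l\<close> be the limit of \<open>avoid\<close>. The energy pairing of
  \<open>hit a n\<close> with a test function \<open>g\<close> tends to
  \<open>2 * (g a * (total a * l a))\<close>, while Cauchy-Schwarz bounds its square by the small
  energy of \<open>g\<close> times a bounded quantity. Hence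
  \<open>total a * l a = 0\<close>.\<close>

lemma avoid_tendsto_0:
  assumes ex: "\<And>\<epsilon>. 0 < \<epsilon> \<Longrightarrow> \<exists>F g. finite F \<and> (\<forall>x. x \<notin> F \<longrightarrow> g x = 0) \<and> 1 \<le> g a \<and> dirichlet E c F g g \<le> \<epsilon>"
  shows "(\<lambda>n. avoid step a n a) \<longlonglongrightarrow> 0"
proof -
  have conv: "convergent (\<lambda>n. avoid step a n x)" for x
    by (intro Bseq_monoseq_convergent decseq_imp_monoseq decseq_SucI avoid_Suc_le BseqI'[where K = 1])
       (auto simp: avoid_nonneg avoid_le_1)
  define l where "l x = lim (\<lambda>n. avoid step a n x)" for x
  have l: "(\<lambda>n. avoid step a n x) \<longlonglongrightarrow> l x" for x
    using conv by (simp add: l_def convergent_LIMSEQ_iff)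
  have l': "(\<lambda>n. avoid step a (Suc n) x) \<longlonglongrightarrow> l x" for x
    using l by (rule LIMSEQ_Suc)
  have l0: "0 \<le> l a"
    by (rule LIMSEQ_le_const[OF l]) (simp add: avoid_nonneg)
  have "2 * (total a * l a) \<le> \<epsilon>" if \<epsilon>: "0 < \<epsilon>" for \<epsilon>
  proof -
    obtain F g where F: "finite F" and g: "\<And>x. x \<notin> F \<Longrightarrow> g x = 0" and ga: "1 \<le> g a"
      and e: "dirichlet E c F g g \<le> \<epsilon>"
      using ex[OF \<epsilon>] by blast
    have aF: "a \<in> F"
      using g ga by force
    \<comment> \<open>The pairing of \<open>hit a n\<close> with \<open>g\<close>, already rewritten
      by Green's formula and the Laplacian of \<open>hit\<close>.\<close>
    define d where "d n = 2 * (\<Sum>x\<in>F. g x * (total x * (avoid step a (Suc n) x -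
        (if x = a then 0 else avoid step a n x))))" for n
    \<comment> \<open>Off \<open>a\<close> the two consecutive values of \<open>avoid\<close> have
      the same limit, so only the term at \<open>a\<close> survives.\<close>
    have "d \<longlonglongrightarrow> 2 * (\<Sum>x\<in>F. g x * (total x * (l x - (if x = a then 0 else l x))))"
      unfolding d_def
      by (intro tendsto_intros l' ) (auto intro: l)
    also have "(\<Sum>x\<in>F. g x * (total x * (l x - (if x = a then 0 else l x)))) =
        (\<Sum>x\<in>F. if x = a then g a * (total a * l a) else 0)"
      by (rule sum.cong) auto
    also have "\<dots> = g a * (total a * l a)"
      using F aF by simp
    finally have d: "d \<longlonglongrightarrow> 2 * (g a * (total a * l a))" .
    have le: "(d n)\<^sup>2 \<le> 2 * (total a * avoid step a (Suc n) a) * \<epsilon>" for n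
    proof -
      let ?S = "{x. hit a n x \<noteq> 0}"
      let ?G = "F \<union> ?S"
      have G: "finite ?G"
        using F finite_support_hit by simp
      have "d n = dirichlet E c F (hit a n) g"
        unfolding d_def
        by (subst dirichlet_green[where g = g, OF F]) (simp_all only: laplacian_hit g not_False_eq_True)
      also have "\<dots> = dirichlet E c ?G (hit a n) g"
        by (rule dirichlet_superset[symmetric]) (use G g in auto)
      finally have "(d n)\<^sup>2 \<le> dirichlet E c ?G (hit a n) (hit a n) * dirichlet E c ?G g g"
        using dirichlet_Cauchy_Schwarz by simp
      also have "dirichlet E c ?G g g = dirichlet E c F g g"
        by (rule dirichlet_superset) (use G g in auto)
      also have "dirichlet E c ?G (hit a n) (hit a n) * dirichlet E c F g g \<le>
          2 * (total a * avoid step a (Suc n) a) * \<epsilon>"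
        by (intro mult_mono e dirichlet_hit_le G) (auto simp: total_nonneg avoid_nonneg dirichlet_nonneg)
      finally show ?thesis .
    qed
    have "(\<lambda>n. 2 * (total a * avoid step a (Suc n) a) * \<epsilon>) \<longlonglongrightarrow> 2 * (total a * l a) * \<epsilon>"
      by (intro tendsto_intros l')
    then have "(2 * (g a * (total a * l a)))\<^sup>2 \<le> 2 * (total a * l a) * \<epsilon>"
      using le by (intro LIMSEQ_le[OF tendsto_power[OF d]]) auto
    moreover have z: "0 \<le> total a * l a"
      using total_nonneg l0 by simp
    have "(2 * (total a * l a))\<^sup>2 \<le> (2 * (g a * (total a * l a)))\<^sup>2"
      using z mult_right_mono[OF ga z] by (intro power_mono) auto
    ultimately have "(2 * (total a * l a)) * (2 * (total a * l a)) \<le> (2 * (total a * l a)) * \<epsilon>"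
      unfolding power2_eq_square by linarith
    then show ?thesis
      using z \<epsilon> mult_le_cancel_left_pos[of "2 * (total a * l a)" "2 * (total a * l a)" \<epsilon>]
      by linarith
  qed
  then have "2 * (total a * l a) \<le> 0"
    using field_le_epsilon[of "2 * (total a * l a)" 0] by simp
  then have "total a * l a = 0"
    using mult_nonneg_nonneg[OF total_nonneg[of a] l0] by linarith
  then consider "l a = 0" | "total a = 0" by auto
  then show ?thesis
  proof cases
    case 1
    then show ?thesis using l[of a] by simp
  next
    \<comment> \<open>The walk stays at \<open>a\<close>, so it has returned at time 1.\<close>
    case 2
    then have *: "avoid step a (Suc n) a = 0" for n
      by (simp add: network_step_def)
    show ?thesis
      by (rule LIMSEQ_imp_Suc) (simp only: * tendsto_const)
  qed
qed

end

subsection \<open>Walks\<close>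

text \<open>The start vertex is not stored, so the length of the list is the number of
  steps.\<close>

primrec walks :: "'v set set \<Rightarrow> nat \<Rightarrow> 'v \<Rightarrow> 'v list set" where
  "walks E 0 x = {[]}"
| "walks E (Suc n) x = (\<Union>y\<in>nbrs E x. (#) y ` walks E n y)"

primrec walk_edges :: "'v \<Rightarrow> 'v list \<Rightarrow> 'v set set" where
  "walk_edges x [] = {}"
| "walk_edges x (y # zs) = insert {x, y} (walk_edges y zs)"

text \<open>Polymorphic because it is used over the reals for Cauchy-Schwarz and over
  \<open>ennreal\<close> for integrals.\<close>

primrec step_sum :: "('v \<Rightarrow> 'v \<Rightarrow> 'b::comm_monoid_add) \<Rightarrow> 'v \<Rightarrow> 'v list \<Rightarrow> 'b" where
  "step_sum \<phi> x [] = 0"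
| "step_sum \<phi> x (y # zs) = \<phi> x y + step_sum \<phi> y zs"

lemma length_walks: "zs \<in> walks E n x \<Longrightarrow> length zs = n"
  by (induction n arbitrary: x zs) auto

lemma walk_edges_subset: "zs \<in> walks E n x \<Longrightarrow> walk_edges x zs \<subseteq> E"
  by (induction n arbitrary: x zs) (simp, fastforce simp: nbrs_def)

lemma finite_walk_edges: "finite (walk_edges x zs)"
  by (induction zs arbitrary: x) auto

lemma Union_walk_edges: "\<Union> (walk_edges x zs) \<subseteq> set (x # zs)"
  by (induction zs arbitrary: x) fastforce+

text \<open>The first edge contains \<open>x\<close>, which a self-avoiding path never meets again.
  Distinct edges give one factor of the opening probability per step.\<close>

lemma card_walk_edges: "distinct (x # zs) \<Longrightarrow> card (walk_edges x zs) = length zs"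
proof (induction zs arbitrary: x)
  case (Cons y zs)
  then have "{x, y} \<notin> walk_edges y zs"
    using Union_walk_edges[of y zs] by auto
  then show ?case
    using Cons by (simp add: finite_walk_edges)
qed simp

lemma rtrancl_path_walks:
  assumes "rtrancl_path (\<lambda>a b. {a, b} \<in> W) x zs y" "W \<subseteq> E"
  shows "zs \<in> walks E (length zs) x \<and> walk_edges x zs \<subseteq> W"
  using assms by (induction rule: rtrancl_path.induct) (auto simp: nbrs_def)

lemma ennreal_step_sum:
  "(\<And>x y. 0 \<le> \<phi> x y) \<Longrightarrow> ennreal (step_sum \<phi> x zs) = step_sum (\<lambda>x y. ennreal (\<phi> x y)) x zs"
proof (induction zs arbitrary: x)
  case (Cons y zs)
  have "0 \<le> step_sum \<phi> y zs" for y
    by (induction zs arbitrary: y) (use Cons.prems in auto)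
  then show ?case
    using Cons by simp
qed simp

text \<open>Cauchy-Schwarz for the telescoping sum of the increments along the walk.\<close>

lemma power2_walk_le:
  fixes f :: "'v \<Rightarrow> real"
  shows "(f x - f (last (x # zs)))\<^sup>2 \<le> real (length zs) * step_sum (\<lambda>x y. (f x - f y)\<^sup>2) x zs"
proof (induction zs arbitrary: x)
  case (Cons y zs)
  define n where "n = real (length zs)"
  define a where "a = f x - f y"
  define b where "b = f y - f (last (y # zs))"
  define S where "S = step_sum (\<lambda>x y. (f x - f y)\<^sup>2) y zs"
  have b: "b\<^sup>2 \<le> n * S"
    using Cons[of y] by (simp add: n_def b_def S_def)
  \<comment> \<open>The cross term is controlled by the square of \<open>n * a - b\<close> and then
    divided by \<open>n\<close>; for \<open>n = 0\<close> both \<open>b\<close> and \<open>S\<close>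
    vanish.\<close>
  have "2 * a * b \<le> n * a\<^sup>2 + S"
  proof (cases "zs = []")
    case True
    then show ?thesis
      by (simp add: n_def b_def S_def)
  next
    case False
    then have n: "0 < n"
      by (simp add: n_def)
    have "n * (2 * a * b) \<le> (n * a)\<^sup>2 + b\<^sup>2"
      using zero_le_power2[of "n * a - b"] by (simp add: power2_diff algebra_simps)
    also have "\<dots> \<le> n * (n * a\<^sup>2 + S)"
      using b by (simp add: power2_eq_square algebra_simps)
    finally show ?thesis
      using n by simp
  qed
  then have "(a + b)\<^sup>2 \<le> (n + 1) * (a\<^sup>2 + S)"
    using b by (simp add: power2_sum algebra_simps)
  then show ?case
    by (simp add: n_def a_def b_def S_def algebra_simps)
qed simp

section \<open>Sums over arcs and walks in a locally finite graph\<close>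

context locally_finite_graph
begin

lemma finite_walks: "finite (walks E n x)"
  by (induction n arbitrary: x) (auto simp: finite_nbrs)

lemma sum_walks_Suc:
  "(\<Sum>zs\<in>walks E (Suc n) x. F zs) = (\<Sum>y\<in>nbrs E x. \<Sum>zs\<in>walks E n y. F (y # zs))"
  unfolding walks.simps
  by (subst sum.UNION_disjoint) (auto simp: finite_nbrs finite_walks sum.reindex)

text \<open>Tonelli for sums over arcs, combined with the symmetry of adjacency.\<close>

lemma nn_integral_nbrs_swap:
  fixes F :: "'v \<Rightarrow> 'v \<Rightarrow> ennreal"
  assumes V: "countable V"
  shows "(\<integral>\<^sup>+x. (\<Sum>y\<in>nbrs E x. F x y) \<partial>count_space V) = (\<integral>\<^sup>+x. (\<Sum>y\<in>nbrs E x. F y x) \<partial>count_space V)"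
proof -
  have eq: "(\<Sum>y\<in>nbrs E x. G y) = (\<integral>\<^sup>+y. G y * indicator (nbrs E x) y \<partial>count_space V)"
    for x and G :: "'v \<Rightarrow> ennreal"
    by (subst nn_integral_count_space'[OF finite_nbrs[of x]]) (use nbrs_subset in auto)
  have "(\<integral>\<^sup>+x. (\<Sum>y\<in>nbrs E x. F x y) \<partial>count_space V) =
      (\<integral>\<^sup>+y. \<integral>\<^sup>+x. F x y * indicator (nbrs E x) y \<partial>count_space V \<partial>count_space V)"
    unfolding eq by (rule nn_integral_count_space_nn_integral[OF V]) simp
  also have "\<dots> = (\<integral>\<^sup>+y. \<integral>\<^sup>+x. F x y * indicator (nbrs E y) x \<partial>count_space V \<partial>count_space V)"
    using nbrs_sym by (intro nn_integral_cong) (auto simp: indicator_def)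
  finally show ?thesis
    unfolding eq .
qed

text \<open>Passes from the finite sum defining the energy to a sum over all of \<open>V\<close>,
  the form in which expectations and walk counts are taken.\<close>

lemma nn_integral_dirichlet:
  assumes F: "finite F" and g: "\<And>x. x \<notin> F \<Longrightarrow> g x = 0"
  shows "(\<integral>\<^sup>+x. (\<Sum>y\<in>nbrs E x. ennreal ((g x - g y)\<^sup>2)) \<partial>count_space V) =
    ennreal (dirichlet E (\<lambda>_. 1) F g g)"
proof -
  let ?T = "arcs_on E F"
  let ?S = "fst ` ?T"
  have gF: "g x \<noteq> 0 \<Longrightarrow> x \<in> F" for x
    using g by blast
  have S: "finite ?S" "?S \<subseteq> V"
    using finite_arcs_on[OF F] edge_vertices by (auto simp: arcs_on_def)
  have zero: "g x = g y" if "{x, y} \<in> E" "(x, y) \<notin> ?T" for x y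
    using that g by (auto simp: arcs_on_def)
  have "(\<integral>\<^sup>+x. (\<Sum>y\<in>nbrs E x. ennreal ((g x - g y)\<^sup>2)) \<partial>count_space V) =
      (\<Sum>x\<in>?S. \<Sum>y\<in>nbrs E x. ennreal ((g x - g y)\<^sup>2))"
  proof (rule nn_integral_count_space'[OF S(1) _ S(2)])
    fix x assume "x \<notin> ?S"
    then have "(x, y) \<notin> ?T" for y
      by force
    then show "(\<Sum>y\<in>nbrs E x. ennreal ((g x - g y)\<^sup>2)) = 0"
      using zero[of x] by (auto simp: nbrs_def intro!: sum.neutral)
  qed
  also have "\<dots> = (\<Sum>x\<in>?S. ennreal (\<Sum>y\<in>nbrs E x. (g x - g y)\<^sup>2))"
    by simp
  also have "\<dots> = ennreal (\<Sum>x\<in>?S. \<Sum>y\<in>nbrs E x. (g x - g y)\<^sup>2)"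
    by (rule sum_ennreal) (simp add: sum_nonneg)
  also have "(\<Sum>x\<in>?S. \<Sum>y\<in>nbrs E x. (g x - g y)\<^sup>2) = (\<Sum>(x, y)\<in>Sigma ?S (nbrs E). (g x - g y)\<^sup>2)"
    using S finite_nbrs by (subst sum.Sigma) auto
  also have "\<dots> = (\<Sum>(x, y)\<in>?T. (g x - g y)\<^sup>2)"
  proof (rule sum.mono_neutral_right)
    show "finite (Sigma ?S (nbrs E))"
      using S finite_nbrs by auto
    show "?T \<subseteq> Sigma ?S (nbrs E)"
      by (force simp: arcs_on_def nbrs_def)
    show "\<forall>p\<in>Sigma ?S (nbrs E) - ?T. (case p of (x, y) \<Rightarrow> (g x - g y)\<^sup>2) = 0"
      using zero by (auto simp: nbrs_def)
  qed
  also have "\<dots> = dirichlet E (\<lambda>_. 1) F g g"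
    by (simp add: dirichlet_def power2_eq_square)
  finally show ?thesis .
qed

text \<open>By connectedness the vertices reached in \<open>n\<close> steps from one vertex,
  finitely many for each \<open>n\<close>, exhaust \<open>V\<close>.\<close>

lemma countable_vertices:
  assumes "connected_graph V E"
  shows "countable V"
proof (cases "V = {}")
  case False
  then obtain a where a: "a \<in> V" by blast
  let ?r = "{(x, y). {x, y} \<in> E}"
  have fin: "finite ((?r ^^ n) `` {a})" for n
  proof (induction n)
    case (Suc n)
    have "(?r ^^ Suc n) `` {a} = (\<Union>y\<in>(?r ^^ n) `` {a}. nbrs E y)"
      by (auto simp: nbrs_def)
    then show ?case
      using Suc finite_nbrs by simp
  qed simp
  have "V \<subseteq> (\<Union>n. (?r ^^ n) `` {a})"
  proof
    fix x assume "x \<in> V"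
    then have "(a, x) \<in> ?r\<^sup>*"
      using assms a by (simp add: connected_graph_def)
    then show "x \<in> (\<Union>n. (?r ^^ n) `` {a})"
      unfolding rtrancl_power by blast
  qed
  then show ?thesis
    by (rule countable_subset) (simp add: countable_finite fin)
qed simp

end

section \<open>Walk counts under bounded degree\<close>

locale bounded_degree_graph = locally_finite_graph V E for V :: "'v set" and E +
  fixes D :: nat
  assumes countable_V: "countable V"
    and card_nbrs_le: "card (nbrs E x) \<le> D"
begin

lemma card_walks_le: "card (walks E n x) \<le> D ^ n"
proof (induction n arbitrary: x)
  case (Suc n)
  have "card (walks E (Suc n) x) = (\<Sum>y\<in>nbrs E x. card (walks E n y))"
    using sum_walks_Suc[where F = "\<lambda>_. 1::nat"] by simp
  also have "\<dots> \<le> (\<Sum>y\<in>nbrs E x. D ^ n)"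
    by (rule sum_mono) (rule Suc)
  also have "\<dots> \<le> D ^ Suc n"
    using card_nbrs_le by simp
  finally show ?case .
qed simp

text \<open>After reversing the arcs, \<open>G x\<close> occurs once for each neighbour of
  \<open>x\<close>.\<close>

lemma nn_integral_nbrs_le:
  fixes G :: "'v \<Rightarrow> ennreal"
  shows "(\<integral>\<^sup>+x. (\<Sum>y\<in>nbrs E x. G y) \<partial>count_space V) \<le> of_nat D * (\<integral>\<^sup>+x. G x \<partial>count_space V)"
proof -
  have "(\<integral>\<^sup>+x. (\<Sum>y\<in>nbrs E x. G y) \<partial>count_space V) = (\<integral>\<^sup>+x. of_nat (card (nbrs E x)) * G x \<partial>count_space V)"
    by (subst nn_integral_nbrs_swap[OF countable_V]) simp
  also have "\<dots> \<le> (\<integral>\<^sup>+x. of_nat D * G x \<partial>count_space V)"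
    by (intro nn_integral_mono mult_right_mono) (auto simp: card_nbrs_le)
  finally show ?thesis
    by (simp add: nn_integral_cmult)
qed

text \<open>
  Each of the \<open>n + 1\<close> steps of a walk contributes the sum of \<open>\<phi>\<close> over all arcs, times at most
  \<open>D ^ n\<close> for the choice of the remaining steps.
\<close>

lemma nn_integral_step_sum_le:
  fixes \<phi> :: "'v \<Rightarrow> 'v \<Rightarrow> ennreal"
  shows "(\<integral>\<^sup>+x. (\<Sum>zs\<in>walks E (Suc n) x. step_sum \<phi> x zs) \<partial>count_space V) \<le>
    of_nat (Suc n * D ^ n) * (\<integral>\<^sup>+x. (\<Sum>y\<in>nbrs E x. \<phi> x y) \<partial>count_space V)"
proof (induction n)
  case 0
  show ?case
    unfolding sum_walks_Suc by simp
next
  case (Suc n)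
  let ?\<Phi> = "\<integral>\<^sup>+x. (\<Sum>y\<in>nbrs E x. \<phi> x y) \<partial>count_space V"
  let ?G = "\<lambda>y. \<Sum>zs\<in>walks E (Suc n) y. step_sum \<phi> y zs"
  \<comment> \<open>The first step is counted once per continuation; the remaining steps form a
    shorter walk from \<open>y\<close>.\<close>
  have "(\<Sum>zs\<in>walks E (Suc (Suc n)) x. step_sum \<phi> x zs) \<le>
      of_nat (D ^ Suc n) * (\<Sum>y\<in>nbrs E x. \<phi> x y) + (\<Sum>y\<in>nbrs E x. ?G y)" for x
  proof -
    have "(\<Sum>zs\<in>walks E (Suc (Suc n)) x. step_sum \<phi> x zs) =
        (\<Sum>y\<in>nbrs E x. of_nat (card (walks E (Suc n) y)) * \<phi> x y + ?G y)"
      unfolding sum_walks_Suc[where n = "Suc n"] by (simp add: sum.distrib del: walks.simps)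
    also have "\<dots> \<le> (\<Sum>y\<in>nbrs E x. of_nat (D ^ Suc n) * \<phi> x y + ?G y)"
      using card_walks_le[of "Suc n"]
      by (intro sum_mono add_right_mono mult_right_mono) (auto simp del: walks.simps of_nat_power power_Suc)
    finally show ?thesis
      by (simp add: sum.distrib sum_distrib_left)
  qed
  then have "(\<integral>\<^sup>+x. (\<Sum>zs\<in>walks E (Suc (Suc n)) x. step_sum \<phi> x zs) \<partial>count_space V) \<le>
      (\<integral>\<^sup>+x. of_nat (D ^ Suc n) * (\<Sum>y\<in>nbrs E x. \<phi> x y) + (\<Sum>y\<in>nbrs E x. ?G y) \<partial>count_space V)"
    by (intro nn_integral_mono)
  also have "\<dots> = of_nat (D ^ Suc n) * ?\<Phi> + (\<integral>\<^sup>+x. (\<Sum>y\<in>nbrs E x. ?G y) \<partial>count_space V)"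
    by (subst nn_integral_add) (simp_all add: nn_integral_cmult)
  also have "\<dots> \<le> of_nat (D ^ Suc n) * ?\<Phi> + of_nat D * (of_nat (Suc n * D ^ n) * ?\<Phi>)"
    by (intro add_left_mono order_trans[OF nn_integral_nbrs_le] mult_left_mono Suc) simp
  also have "\<dots> = of_nat (D ^ Suc n + D * (Suc n * D ^ n)) * ?\<Phi>"
    by (simp only: of_nat_add of_nat_mult distrib_right mult.assoc)
  also have "D ^ Suc n + D * (Suc n * D ^ n) = Suc (Suc n) * D ^ Suc n"
    by (simp add: algebra_simps)
  finally show ?case .
qed

end

subsection \<open>Subcritical percolation\<close>

text \<open>For the expected path energy: one factor \<open>Suc n\<close> comes from Cauchy-Schwarz
  along a walk, the other from the position of a step in it.\<close>

lemma summable_square_times_power: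
  fixes r :: real
  assumes "0 \<le> r" "r < 1"
  shows "summable (\<lambda>n. real (Suc n * Suc n) * r ^ n)"
proof (cases "r = 0")
  case True
  then show ?thesis
    by (intro summable_finite[of "{0}"]) auto
next
  case False
  show ?thesis
  proof (rule summable_comparison_test_bigo)
    show "summable (\<lambda>n. norm (1 / real n ^ 2))"
      using inverse_power_summable[of 2, where 'a = real] by (simp add: inverse_eq_divide)
    show "(\<lambda>n. real (Suc n * Suc n) * r ^ n) \<in> O(\<lambda>n. 1 / real n ^ 2)"
      using assms False by real_asymp
  qed
qed

lemma borel_measurable_nn_integral_count_space:
  fixes f :: "'i \<Rightarrow> 'a \<Rightarrow> ennreal"
  assumes A: "countable A" and f: "\<And>i. i \<in> A \<Longrightarrow> f i \<in> borel_measurable M"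
  shows "(\<lambda>x. \<integral>\<^sup>+i. f i x \<partial>count_space A) \<in> borel_measurable M"
proof -
  interpret sigma_finite_measure "count_space A"
    by (rule sigma_finite_measure_count_space_countable[OF A])
  have "(\<lambda>p. f (snd p) (fst p)) \<in> borel_measurable (M \<Otimes>\<^sub>M count_space A)"
    by (rule measurable_compose_countable'[where f = "\<lambda>i p. f i (fst p)" and g = snd and I = A])
       (use A in \<open>auto intro: measurable_compose[OF measurable_fst f]\<close>)
  then show ?thesis
    by (intro borel_measurable_nn_integral) (simp add: case_prod_beta')
qed

text \<open>A vertex starts at most \<open>D ^ n\<close> walks of \<open>n\<close> steps, so an open
  self-avoiding one exists with probability at most \<open>(p * D) ^ n\<close>; this is the sense of
  subcriticality.\<close>

locale subcritical_percolation =
  prob_space M + bounded_degree_graph V E D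
  for M :: "'a measure" and V :: "'v set" and E D +
  fixes W :: "'a \<Rightarrow> 'v set set" and p :: real
  assumes W_subset: "W \<omega> \<subseteq> E"
    and p: "0 \<le> p" "p * real D < 1"
    and sets_open: "finite J \<Longrightarrow> J \<subseteq> E \<Longrightarrow> {\<omega>\<in>space M. J \<subseteq> W \<omega>} \<in> sets M"
    and prob_open: "finite J \<Longrightarrow> J \<subseteq> E \<Longrightarrow> prob {\<omega>\<in>space M. J \<subseteq> W \<omega>} \<le> p ^ card J"
begin

section \<open>Open clusters and their finiteness\<close>

definition cluster :: "'a \<Rightarrow> 'v \<Rightarrow> 'v set" where
  "cluster \<omega> x = {y. (x, y) \<in> {(a, b). {a, b} \<in> W \<omega>}\<^sup>*}"

text \<open>The list includes the start vertex. Distinctness makes the edges distinct, so that each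
  contributes a factor \<open>p\<close>.\<close>

definition open_path :: "'v list \<Rightarrow> 'a set" where
  "open_path zs = {\<omega>\<in>space M. distinct zs \<and> walk_edges (hd zs) (tl zs) \<subseteq> W \<omega>}"

lemma open_path_event:
  assumes "zs \<in> walks E n x"
  shows "open_path (x # zs) \<in> sets M" and "prob (open_path (x # zs)) \<le> p ^ n"
proof -
  have J: "finite (walk_edges x zs)" "walk_edges x zs \<subseteq> E"
    using finite_walk_edges walk_edges_subset[OF assms] by auto
  show "open_path (x # zs) \<in> sets M"
    using sets_open[OF J] by (cases "distinct (x # zs)") (auto simp: open_path_def)
  show "prob (open_path (x # zs)) \<le> p ^ n"
    using prob_open[OF J] card_walk_edges[of x zs] length_walks[OF assms] p
    by (cases "distinct (x # zs)") (auto simp: open_path_def)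
qed

text \<open>Loop erasure makes any open connection self-avoiding.\<close>

lemma cluster_open_path:
  assumes "\<omega> \<in> space M" "y \<in> cluster \<omega> x"
  obtains zs where "zs \<in> walks E (length zs) x" "\<omega> \<in> open_path (x # zs)" "last (x # zs) = y"
proof -
  let ?r = "\<lambda>a b. {a, b} \<in> W \<omega>"
  have "?r\<^sup>*\<^sup>* x y"
    using assms(2) by (simp add: cluster_def rtrancl_def)
  then obtain zs0 where "rtrancl_path ?r x zs0 y"
    by (auto simp: rtranclp_eq_rtrancl_path)
  then obtain zs where zs: "rtrancl_path ?r x zs y" "distinct (x # zs)"
    by (rule rtrancl_path_distinct)
  have "last (x # zs) = y"
    using zs(1) by (cases "zs = []") (auto dest: rtrancl_path_last elim: rtrancl_path.cases)
  then show ?thesis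
    using that[of zs] rtrancl_path_walks[OF zs(1) W_subset] zs(2) assms(1)
    by (simp add: open_path_def)
qed

lemma cluster_refl: "x \<in> cluster \<omega> x"
  by (simp add: cluster_def)

lemma cluster_outside:
  assumes "x \<notin> V"
  shows "cluster \<omega> x = {x}"
proof -
  have "y = x" if "(x, y) \<in> {(a, b). {a, b} \<in> W \<omega>}\<^sup>*" for y
    using that by (cases rule: converse_rtranclE) (use assms W_subset edge_vertices in auto)
  then show ?thesis
    unfolding cluster_def by auto
qed

lemma cluster_sym: "y \<in> cluster \<omega> x \<longleftrightarrow> x \<in> cluster \<omega> y"
proof -
  have "sym {(a, b). {a, b} \<in> W \<omega>}"
    by (auto simp: sym_def insert_commute)
  then show ?thesis
    unfolding cluster_def by (auto dest: sym_rtrancl symD)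
qed

lemma cluster_eq:
  assumes "{x, y} \<in> W \<omega>"
  shows "cluster \<omega> x = cluster \<omega> y"
proof -
  have "(x, y) \<in> {(a, b). {a, b} \<in> W \<omega>}" "(y, x) \<in> {(a, b). {a, b} \<in> W \<omega>}"
    using assms by (auto simp: insert_commute)
  then show ?thesis
    unfolding cluster_def by (blast intro: converse_rtrancl_into_rtrancl)
qed

text \<open>Borel-Cantelli: the probabilities of an open self-avoiding path of \<open>n\<close>
  steps from \<open>x\<close> are summable, so almost surely such paths have bounded length, and
  their end points are finitely many.\<close>

lemma AE_finite_cluster: "AE \<omega> in M. finite (cluster \<omega> x)"
proof -
  let ?A = "\<lambda>n. \<Union>zs\<in>walks E n x. open_path (x # zs)"
  have A: "?A n \<in> sets M" for n
    using open_path_event(1) finite_walks by blast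
  have "prob (?A n) \<le> (p * real D) ^ n" for n
  proof -
    have "prob (?A n) \<le> (\<Sum>zs\<in>walks E n x. prob (open_path (x # zs)))"
      using open_path_event(1) by (intro finite_measure_subadditive_finite finite_walks) auto
    also have "\<dots> \<le> (\<Sum>zs\<in>walks E n x. p ^ n)"
      by (intro sum_mono open_path_event(2))
    also have "\<dots> = real (card (walks E n x)) * p ^ n"
      by simp
    also have "\<dots> \<le> real (D ^ n) * p ^ n"
      using p card_walks_le[of n x] by (intro mult_right_mono of_nat_mono) auto
    finally show ?thesis
      by (simp add: power_mult_distrib mult.commute)
  qed
  then have "summable (\<lambda>n. prob (?A n))"
    using p by (intro summable_comparison_test'[OF summable_geometric[of "p * real D"]]) auto
  then have "AE \<omega> in M. eventually (\<lambda>n. \<omega> \<in> space M - ?A n) sequentially"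
    using A by (intro borel_cantelli_AE1) (auto simp: emeasure_eq_measure)
  then show ?thesis
  proof eventually_elim
    case (elim \<omega>)
    then obtain N where N: "\<And>n. N \<le> n \<Longrightarrow> \<omega> \<in> space M - ?A n"
      by (auto simp: eventually_sequentially)
    have "cluster \<omega> x \<subseteq> (\<Union>n<N. (\<lambda>zs. last (x # zs)) ` walks E n x)"
    proof
      fix y assume "y \<in> cluster \<omega> x"
      then obtain zs where zs: "zs \<in> walks E (length zs) x" "\<omega> \<in> open_path (x # zs)" "last (x # zs) = y"
        using N[of N] by (metis DiffD1 cluster_open_path order_refl)
      then have "length zs < N"
        using N[of "length zs"] by (cases "length zs < N") auto
      then show "y \<in> (\<Union>n<N. (\<lambda>zs. last (x # zs)) ` walks E n x)"
        using zs by blast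
    qed
    then show ?case
      by (rule finite_subset) (auto simp: finite_walks)
  qed
qed

section \<open>Maxima over clusters and the expected energy of open paths\<close>

definition cluster_max :: "('v \<Rightarrow> real) \<Rightarrow> 'a \<Rightarrow> 'v \<Rightarrow> real" where
  "cluster_max f \<omega> x = Max (f ` cluster \<omega> x)"

definition sq_diff :: "('v \<Rightarrow> real) \<Rightarrow> 'v \<Rightarrow> 'v \<Rightarrow> ennreal" where
  "sq_diff f x y = ennreal ((f x - f y)\<^sup>2)"

text \<open>The factor \<open>Suc n\<close> is the Cauchy-Schwarz constant for a walk of
  \<open>Suc n\<close> steps.\<close>

definition path_term :: "('v \<Rightarrow> real) \<Rightarrow> nat \<Rightarrow> 'a \<Rightarrow> 'v \<Rightarrow> 'v list \<Rightarrow> ennreal" where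
  "path_term f n \<omega> x zs = of_nat (Suc n) * step_sum (sq_diff f) x zs * indicator (open_path zs) \<omega>"

text \<open>
  The first step of the walk \<open>x # zs\<close> is the arc across which \<open>cluster_max f\<close> is compared; only
  the remaining steps \<open>zs\<close> have to be open.
\<close>

definition path_energy :: "('v \<Rightarrow> real) \<Rightarrow> 'a \<Rightarrow> ennreal" where
  "path_energy f \<omega> =
     (\<Sum>n. \<integral>\<^sup>+x. (\<Sum>zs\<in>walks E (Suc n) x. path_term f n \<omega> x zs) \<partial>count_space V)"

lemma open_path_walk_event:
  assumes "zs \<in> walks E (Suc n) x"
  shows "open_path zs \<in> sets M" and "prob (open_path zs) \<le> p ^ n"
  using assms open_path_event by auto

lemma measurable_path_sum [measurable]:
  "(\<lambda>\<omega>. \<Sum>zs\<in>walks E (Suc n) x. path_term f n \<omega> x zs) \<in> borel_measurable M"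
  unfolding path_term_def using open_path_walk_event(1)
  by (intro borel_measurable_sum borel_measurable_times borel_measurable_indicator) auto

lemma measurable_path_energy [measurable]: "path_energy f \<in> borel_measurable M"
proof -
  have "(\<lambda>\<omega>. \<integral>\<^sup>+x. (\<Sum>zs\<in>walks E (Suc n) x. path_term f n \<omega> x zs) \<partial>count_space V) \<in> borel_measurable M" for n
    by (rule borel_measurable_nn_integral_count_space[OF countable_V measurable_path_sum])
  then show ?thesis
    unfolding path_energy_def by measurable
qed

text \<open>By Tonelli the expectation moves inside. The open part of a walk of \<open>Suc n\<close>
  steps has probability at most \<open>p ^ n\<close>, the walk count gives
  \<open>Suc n * D ^ n\<close>, and Cauchy-Schwarz gave \<open>Suc n\<close>.\<close>

lemma nn_integral_path_energy_le:
  "(\<integral>\<^sup>+\<omega>. path_energy f \<omega> \<partial>M) \<le>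
     ennreal (\<Sum>n. real (Suc n * Suc n) * (p * real D) ^ n) *
     (\<integral>\<^sup>+x. (\<Sum>y\<in>nbrs E x. sq_diff f x y) \<partial>count_space V)"
proof -
  let ?\<Phi> = "\<integral>\<^sup>+x. (\<Sum>y\<in>nbrs E x. sq_diff f x y) \<partial>count_space V"
  let ?k = "\<lambda>n. real (Suc n * Suc n) * (p * real D) ^ n"
  have k: "summable ?k" "\<And>n. 0 \<le> ?k n"
    using summable_square_times_power[of "p * real D"] p by simp_all
  have le: "(\<integral>\<^sup>+\<omega>. (\<integral>\<^sup>+x. (\<Sum>zs\<in>walks E (Suc n) x. path_term f n \<omega> x zs) \<partial>count_space V) \<partial>M) \<le>
      ennreal (?k n) * ?\<Phi>" for n
  proof -
    have "(\<integral>\<^sup>+\<omega>. (\<integral>\<^sup>+x. (\<Sum>zs\<in>walks E (Suc n) x. path_term f n \<omega> x zs) \<partial>count_space V) \<partial>M) =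
        (\<integral>\<^sup>+x. (\<integral>\<^sup>+\<omega>. (\<Sum>zs\<in>walks E (Suc n) x. path_term f n \<omega> x zs) \<partial>M) \<partial>count_space V)"
      by (rule nn_integral_count_space_nn_integral[OF countable_V measurable_path_sum])
    also have "\<dots> \<le> (\<integral>\<^sup>+x. (of_nat (Suc n) * ennreal (p ^ n)) *
        (\<Sum>zs\<in>walks E (Suc n) x. step_sum (sq_diff f) x zs) \<partial>count_space V)"
    proof (rule nn_integral_mono)
      fix x
      have "(\<integral>\<^sup>+\<omega>. (\<Sum>zs\<in>walks E (Suc n) x. path_term f n \<omega> x zs) \<partial>M) =
          (\<Sum>zs\<in>walks E (Suc n) x. of_nat (Suc n) * step_sum (sq_diff f) x zs * emeasure M (open_path zs))"
        unfolding path_term_def using open_path_walk_event(1)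
        by (subst nn_integral_sum) (auto intro!: sum.cong nn_integral_cmult_indicator simp del: walks.simps)
      also have "\<dots> \<le> (\<Sum>zs\<in>walks E (Suc n) x. of_nat (Suc n) * step_sum (sq_diff f) x zs * ennreal (p ^ n))"
        using open_path_walk_event(2)
        by (intro sum_mono mult_left_mono) (auto simp: emeasure_eq_measure intro!: ennreal_leI simp del: walks.simps)
      finally show "(\<integral>\<^sup>+\<omega>. (\<Sum>zs\<in>walks E (Suc n) x. path_term f n \<omega> x zs) \<partial>M) \<le>
          (of_nat (Suc n) * ennreal (p ^ n)) * (\<Sum>zs\<in>walks E (Suc n) x. step_sum (sq_diff f) x zs)"
        by (simp add: sum_distrib_left mult_ac del: walks.simps)
    qed
    also have "\<dots> = (of_nat (Suc n) * ennreal (p ^ n)) *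
        (\<integral>\<^sup>+x. (\<Sum>zs\<in>walks E (Suc n) x. step_sum (sq_diff f) x zs) \<partial>count_space V)"
      by (rule nn_integral_cmult) simp
    also have "\<dots> \<le> (of_nat (Suc n) * ennreal (p ^ n)) * (of_nat (Suc n * D ^ n) * ?\<Phi>)"
      by (intro mult_left_mono nn_integral_step_sum_le) simp
    also have "\<dots> = ennreal (real (Suc n) * p ^ n * real (Suc n * D ^ n)) * ?\<Phi>"
      using p by (simp only: ennreal_of_nat_eq_real_of_nat ennreal_mult mult.assoc of_nat_0_le_iff
          zero_le_power mult_nonneg_nonneg)
    also have "real (Suc n) * p ^ n * real (Suc n * D ^ n) = ?k n"
      by (simp only: of_nat_mult of_nat_power power_mult_distrib mult_ac)
    finally show ?thesis .
  qed
  have "(\<integral>\<^sup>+\<omega>. path_energy f \<omega> \<partial>M) =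
      (\<Sum>n. \<integral>\<^sup>+\<omega>. (\<integral>\<^sup>+x. (\<Sum>zs\<in>walks E (Suc n) x. path_term f n \<omega> x zs) \<partial>count_space V) \<partial>M)"
    unfolding path_energy_def
    by (intro nn_integral_suminf borel_measurable_nn_integral_count_space[OF countable_V] measurable_path_sum)
  also have "\<dots> \<le> (\<Sum>n. ennreal (?k n) * ?\<Phi>)"
    by (intro suminf_le le) auto
  also have "\<dots> = ennreal (\<Sum>n. ?k n) * ?\<Phi>"
    using k by (simp add: suminf_ennreal2 ennreal_suminf_multc)
  finally show ?thesis .
qed

lemma cluster_max_attained:
  assumes "finite (cluster \<omega> x)"
  obtains w where "w \<in> cluster \<omega> x" "cluster_max f \<omega> x = f w"
proof -
  have "cluster_max f \<omega> x \<in> f ` cluster \<omega> x"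
    unfolding cluster_max_def using assms cluster_refl[of x \<omega>] by (intro Max_in) auto
  then show ?thesis using that by blast
qed

lemma cluster_max_ge: "finite (cluster \<omega> x) \<Longrightarrow> f x \<le> cluster_max f \<omega> x"
  unfolding cluster_max_def by (rule Max_ge) (auto intro: cluster_refl)

text \<open>Let \<open>w\<close> attain the maximum over the cluster of \<open>y\<close>. The
  difference of the maxima is at most \<open>f w - f x\<close>, an increment along the arc to
  \<open>y\<close> followed by an open path to \<open>w\<close>. That path is one term of the
  sum.\<close>

lemma sq_diff_cluster_max_le:
  assumes \<omega>: "\<omega> \<in> space M" and fin: "\<And>x. finite (cluster \<omega> x)"
    and xy: "y \<in> nbrs E x" and le: "cluster_max f \<omega> x \<le> cluster_max f \<omega> y"
  shows "sq_diff (cluster_max f \<omega>) x y \<le> (\<Sum>n. \<Sum>zs\<in>walks E n y. path_term f n \<omega> x (y # zs))"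
proof -
  obtain w where w: "w \<in> cluster \<omega> y" "cluster_max f \<omega> y = f w"
    using cluster_max_attained[OF fin] by metis
  obtain zs where zs: "zs \<in> walks E (length zs) y" "\<omega> \<in> open_path (y # zs)" "last (y # zs) = w"
    using cluster_open_path[OF \<omega> w(1)] by metis
  let ?n = "length zs"
  have "(cluster_max f \<omega> x - cluster_max f \<omega> y)\<^sup>2 = (cluster_max f \<omega> y - cluster_max f \<omega> x)\<^sup>2"
    by (rule power2_commute)
  also have "\<dots> \<le> (f w - f x)\<^sup>2"
    using le cluster_max_ge[OF fin, where f = f and x = x] by (intro power_mono) (auto simp: w(2))
  also have "\<dots> = (f x - f (last (x # y # zs)))\<^sup>2"
    using zs(3) by (simp add: power2_commute)
  also have "\<dots> \<le> real (Suc ?n) * step_sum (\<lambda>x y. (f x - f y)\<^sup>2) x (y # zs)"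
    using power2_walk_le[of f x "y # zs"] by simp
  finally have "sq_diff (cluster_max f \<omega>) x y \<le> ennreal (real (Suc ?n) * step_sum (\<lambda>x y. (f x - f y)\<^sup>2) x (y # zs))"
    unfolding sq_diff_def by (rule ennreal_leI)
  also have "\<dots> = path_term f ?n \<omega> x (y # zs)"
    using zs(2) unfolding path_term_def sq_diff_def
    by (simp only: ennreal_mult' of_nat_0_le_iff ennreal_step_sum zero_le_power2
        ennreal_of_nat_eq_real_of_nat indicator_simps mult_1_right)
  also have "\<dots> \<le> (\<Sum>zs\<in>walks E ?n y. path_term f ?n \<omega> x (y # zs))"
    by (rule member_le_sum[where f = "\<lambda>zs. path_term f ?n \<omega> x (y # zs)", OF zs(1)]) (auto simp: finite_walks)
  also have "\<dots> \<le> (\<Sum>n. \<Sum>zs\<in>walks E n y. path_term f n \<omega> x (y # zs))"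
    using sum_le_suminf[of "\<lambda>n. \<Sum>zs\<in>walks E n y. path_term f n \<omega> x (y # zs)" "{?n}"] by simp
  finally show ?thesis .
qed

text \<open>Either end of an arc may have the larger maximum, so both directions are added; by arc
  reversal they have equal totals, hence the factor 2.\<close>

lemma energy_cluster_max_le:
  assumes \<omega>: "\<omega> \<in> space M" and fin: "\<And>x. finite (cluster \<omega> x)"
  shows "(\<integral>\<^sup>+x. (\<Sum>y\<in>nbrs E x. sq_diff (cluster_max f \<omega>) x y) \<partial>count_space V) \<le> 2 * path_energy f \<omega>"
proof -
  let ?R = "\<lambda>x y. \<Sum>n. \<Sum>zs\<in>walks E n y. path_term f n \<omega> x (y # zs)"
  have le: "sq_diff (cluster_max f \<omega>) x y \<le> ?R x y + ?R y x" if "y \<in> nbrs E x" for x y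
  proof (cases "cluster_max f \<omega> x \<le> cluster_max f \<omega> y")
    case True
    show ?thesis
      by (rule order_trans[OF sq_diff_cluster_max_le[OF \<omega> fin that True]]) simp
  next
    case False
    have "sq_diff (cluster_max f \<omega>) x y = sq_diff (cluster_max f \<omega>) y x"
      by (simp add: sq_diff_def power2_commute)
    also have "\<dots> \<le> ?R y x"
      by (rule sq_diff_cluster_max_le[OF \<omega> fin]) (use that False nbrs_sym in auto)
    finally show ?thesis
      by (rule order_trans) simp
  qed
  have R: "(\<integral>\<^sup>+x. (\<Sum>y\<in>nbrs E x. ?R x y) \<partial>count_space V) = path_energy f \<omega>"
  proof -
    have "(\<Sum>y\<in>nbrs E x. ?R x y) = (\<Sum>n. \<Sum>zs\<in>walks E (Suc n) x. path_term f n \<omega> x zs)" for x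
      unfolding sum_walks_Suc by (rule suminf_sum[symmetric]) auto
    then show ?thesis
      unfolding path_energy_def by (simp add: nn_integral_suminf del: walks.simps)
  qed
  have "(\<integral>\<^sup>+x. (\<Sum>y\<in>nbrs E x. sq_diff (cluster_max f \<omega>) x y) \<partial>count_space V) \<le>
      (\<integral>\<^sup>+x. (\<Sum>y\<in>nbrs E x. ?R x y) + (\<Sum>y\<in>nbrs E x. ?R y x) \<partial>count_space V)"
    unfolding sum.distrib[symmetric] by (intro nn_integral_mono sum_mono le)
  also have "\<dots> = path_energy f \<omega> + (\<integral>\<^sup>+x. (\<Sum>y\<in>nbrs E x. ?R y x) \<partial>count_space V)"
    by (subst nn_integral_add) (simp_all only: R borel_measurable_count_space)
  also have "(\<integral>\<^sup>+x. (\<Sum>y\<in>nbrs E x. ?R y x) \<partial>count_space V) = path_energy f \<omega>"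
    unfolding R[symmetric] by (rule nn_integral_nbrs_swap[OF countable_V, symmetric])
  finally show ?thesis
    by (simp only: mult_2)
qed

text \<open>A nonzero maximum at \<open>x\<close> is a value of \<open>f\<close> at some
  \<open>w\<close> in its cluster, and then \<open>x\<close> lies in the finite cluster of
  \<open>w\<close>.\<close>

lemma finite_support_cluster_max:
  assumes fin: "\<And>x. finite (cluster \<omega> x)" and f: "finite {x. f x \<noteq> 0}"
  shows "finite {x. cluster_max f \<omega> x \<noteq> 0}"
proof (rule finite_subset)
  show "{x. cluster_max f \<omega> x \<noteq> 0} \<subseteq> (\<Union>w\<in>{x. f x \<noteq> 0}. cluster \<omega> w)"
  proof
    fix x assume x: "x \<in> {x. cluster_max f \<omega> x \<noteq> 0}"
    obtain w where "w \<in> cluster \<omega> x" "cluster_max f \<omega> x = f w"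
      using cluster_max_attained[OF fin] by metis
    then show "x \<in> (\<Union>w\<in>{x. f x \<noteq> 0}. cluster \<omega> w)"
      using x cluster_sym by auto
  qed
  show "finite (\<Union>w\<in>{x. f x \<noteq> 0}. cluster \<omega> w)"
    using f fin by simp
qed

text \<open>The expected infimum over \<open>n\<close> is at most every expected energy, and these
  tend to 0. So the infimum vanishes almost surely.\<close>

lemma AE_path_energy_small:
  fixes f :: "nat \<Rightarrow> 'v \<Rightarrow> real"
  assumes fin: "\<And>n. finite {x. f n x \<noteq> 0}"
    and lim: "(\<lambda>n. dirichlet E (\<lambda>_. 1) {x. f n x \<noteq> 0} (f n) (f n)) \<longlonglongrightarrow> 0"
  shows "AE \<omega> in M. \<forall>\<epsilon>>0. \<exists>n. path_energy (f n) \<omega> < ennreal \<epsilon>"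
proof -
  let ?d = "\<lambda>n. dirichlet E (\<lambda>_. 1) {x. f n x \<noteq> 0} (f n) (f n)"
  define k where "k = (\<Sum>n. real (Suc n * Suc n) * (p * real D) ^ n)"
  have k: "0 \<le> k"
    unfolding k_def using p by (intro suminf_nonneg summable_square_times_power) auto
  have "(\<integral>\<^sup>+\<omega>. (INF n. path_energy (f n) \<omega>) \<partial>M) \<le> ennreal (k * ?d n)" for n
  proof -
    have "(\<integral>\<^sup>+\<omega>. (INF n. path_energy (f n) \<omega>) \<partial>M) \<le> (\<integral>\<^sup>+\<omega>. path_energy (f n) \<omega> \<partial>M)"
      by (intro nn_integral_mono INF_lower) simp
    also have "\<dots> \<le> ennreal k * ennreal (?d n)"
      using nn_integral_path_energy_le[of "f n"] nn_integral_dirichlet[OF fin[of n], where g = "f n"]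
      by (simp add: sq_diff_def k_def)
    finally show ?thesis
      using k by (simp add: ennreal_mult')
  qed
  moreover have "(\<lambda>n. ennreal (k * ?d n)) \<longlonglongrightarrow> ennreal (k * 0)"
    by (intro tendsto_ennrealI tendsto_intros lim)
  ultimately have "(\<integral>\<^sup>+\<omega>. (INF n. path_energy (f n) \<omega>) \<partial>M) \<le> ennreal (k * 0)"
    by (intro LIMSEQ_le_const) auto
  then have "AE \<omega> in M. (INF n. path_energy (f n) \<omega>) = 0"
    by (subst nn_integral_0_iff_AE[symmetric]) auto
  then show ?thesis
  proof eventually_elim
    case (elim \<omega>)
    show ?case
    proof (intro allI impI)
      fix \<epsilon> :: real assume "0 < \<epsilon>"
      then have "(INF n. path_energy (f n) \<omega>) < ennreal \<epsilon>"
        using elim by simp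
      then show "\<exists>n. path_energy (f n) \<omega> < ennreal \<epsilon>"
        by (auto simp: INF_less_iff)
    qed
  qed
qed

lemma dirichlet_cluster_max_less:
  assumes \<omega>: "\<omega> \<in> space M" and fin: "\<And>x. finite (cluster \<omega> x)" and f: "finite {x. f x \<noteq> 0}"
    and small: "path_energy f \<omega> < ennreal \<epsilon>"
  shows "dirichlet E (\<lambda>_. 1) {x. cluster_max f \<omega> x \<noteq> 0} (cluster_max f \<omega>) (cluster_max f \<omega>) < 2 * \<epsilon>"
proof -
  let ?g = "cluster_max f \<omega>"
  have \<epsilon>: "0 < \<epsilon>"
    using small by (cases "0 < \<epsilon>") (auto simp: ennreal_neg)
  have "ennreal (dirichlet E (\<lambda>_. 1) {x. ?g x \<noteq> 0} ?g ?g) =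
      (\<integral>\<^sup>+x. (\<Sum>y\<in>nbrs E x. sq_diff ?g x y) \<partial>count_space V)"
    unfolding sq_diff_def
    by (rule nn_integral_dirichlet[OF finite_support_cluster_max[OF fin f], symmetric]) simp
  also have "\<dots> \<le> 2 * path_energy f \<omega>"
    by (rule energy_cluster_max_le[OF \<omega> fin])
  also have "\<dots> < 2 * ennreal \<epsilon>"
    using small by (intro ennreal_mult_strict_left_mono) auto
  also have "\<dots> = ennreal (2 * \<epsilon>)"
    using \<epsilon> by (simp add: ennreal_mult)
  finally show ?thesis
    by (meson ennreal_leI not_le)
qed

end

subsection \<open>Random conductances\<close>

theorem theorem1p9:
  fixes V :: "'v set" and E :: "'v set set"
    and M :: "'a measure" and C :: "'v set \<Rightarrow> 'a \<Rightarrow> real" and \<mu> :: "real measure"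
  assumes "simple_graph V E" and "infinite V" and "connected_graph V E"
    and "bounded_degree V E"
    and "recurrent_graph V E"
    and "prob_space M"
    and "prob_space.indep_vars M (\<lambda>_. borel) C E"
    and "\<And>e. e \<in> E \<Longrightarrow> distr M borel (C e) = \<mu>"
    and "\<And>e \<omega>. e \<in> E \<Longrightarrow> \<omega> \<in> space M \<Longrightarrow> 0 \<le> C e \<omega>"
  shows "AE \<omega> in M. recurrent_network V E (\<lambda>e. C e \<omega>)"
proof -
  interpret prob_space M by fact
  obtain D where D: "\<And>v. v \<in> V \<Longrightarrow> finite (incident E v) \<and> card (incident E v) \<le> D"
    using \<open>bounded_degree V E\<close> by (auto simp: bounded_degree_def)
  interpret G: locally_finite_graph V E
    using \<open>simple_graph V E\<close> D by unfold_locales auto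
  have V: "countable V"
    by (rule G.countable_vertices) fact
  have nbrs: "card (nbrs E x) \<le> D" for x
  proof (cases "x \<in> V")
    case False
    then have "nbrs E x = {}"
      using G.edge_vertices by (auto simp: nbrs_def)
    then show ?thesis by simp
  qed (simp add: D G.card_nbrs)
  have C [measurable]: "C e \<in> borel_measurable M" if "e \<in> E" for e
    using \<open>indep_vars (\<lambda>_. borel) C E\<close> that by (simp add: indep_vars_def)
  \<comment> \<open>A fixed edge serves to express the common law of the conductances.\<close>
  have "E \<noteq> {}"
  proof
    assume "E = {}"
    then have "\<forall>u\<in>V. \<forall>v\<in>V. u = v"
      using \<open>connected_graph V E\<close> by (simp add: connected_graph_def)
    then show False
      using \<open>infinite V\<close> by (metis finite.simps infinite_imp_nonempty singletonI subsetI finite_subset ex_in_conv)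
  qed
  then obtain e0 where e0: "e0 \<in> E" by blast
  have q: "prob (C e -` A \<inter> space M) = prob (C e0 -` A \<inter> space M)" if "e \<in> E" "A \<in> sets borel" for e A
    using that e0 assms(8) by (metis C measure_distr)
  \<comment> \<open>Conductances are finite, so their tails vanish. A tail below
    \<open>1 / (D + 1)\<close> gives \<open>p * D < 1\<close>, and this bound makes sense for
    \<open>D = 0\<close> too.\<close>
  have "(\<lambda>n. prob (C e0 -` {real n<..} \<inter> space M)) \<longlonglongrightarrow> prob (\<Inter>n. C e0 -` {real n<..} \<inter> space M)"
    using C[OF e0] by (intro finite_Lim_measure_decseq) (auto simp: decseq_def)
  also have "(\<Inter>n. C e0 -` {real n<..} \<inter> space M) = {}"
  proof -
    have "\<exists>n. \<not> real n < x" for x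
      using reals_Archimedean2[of x] by (meson less_asym)
    then show ?thesis by auto
  qed
  finally have "eventually (\<lambda>n. prob (C e0 -` {real n<..} \<inter> space M) < 1 / (real D + 1)) sequentially"
    by (rule order_tendstoD) simp
  then obtain L :: nat where L: "prob (C e0 -` {real L<..} \<inter> space M) < 1 / (real D + 1)"
    by (auto simp: eventually_sequentially)
  define p where "p = prob (C e0 -` {real L<..} \<inter> space M)"
  define W where "W \<omega> = {e \<in> E. real L < C e \<omega>}" for \<omega>
  have p: "0 \<le> p" "p * real D < 1"
  proof -
    have "p * (real D + 1) < 1"
      using L by (simp add: p_def field_simps)
    moreover show "0 \<le> p"
      by (simp add: p_def)
    ultimately show "p * real D < 1"
      by (simp add: algebra_simps)
  qed
  interpret P: subcritical_percolation M V E D W p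
  proof
    fix J assume J: "finite J" "J \<subseteq> E"
    \<comment> \<open>The empty intersection is \<open>UNIV\<close>, so \<open>J = {}\<close> is
      treated apart.\<close>
    have eq: "{\<omega>\<in>space M. J \<subseteq> W \<omega>} = (\<Inter>e\<in>J. C e -` {real L<..} \<inter> space M)" if "J \<noteq> {}"
      using J that by (auto simp: W_def)
    show "{\<omega>\<in>space M. J \<subseteq> W \<omega>} \<in> sets M"
    proof (cases "J = {}")
      case False
      show ?thesis
        unfolding eq[OF False] using J False C by (intro sets.finite_INT measurable_sets[where A = borel]) auto
    qed simp
    show "prob {\<omega>\<in>space M. J \<subseteq> W \<omega>} \<le> p ^ card J"
    proof (cases "J = {}")
      case False
      have "prob {\<omega>\<in>space M. J \<subseteq> W \<omega>} = (\<Prod>e\<in>J. prob (C e -` {real L<..} \<inter> space M))"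
        unfolding eq[OF False] using \<open>indep_vars (\<lambda>_. borel) C E\<close> False J by (intro indep_varsD) auto
      also have "\<dots> = (\<Prod>e\<in>J. p)"
        using J by (intro prod.cong) (auto simp: p_def intro!: q)
      finally show ?thesis by simp
    qed (simp add: prob_space)
  qed (auto simp: W_def V nbrs p)
  interpret U: electrical_network V E "\<lambda>_. 1"
    by unfold_locales simp
  \<comment> \<open>Recurrence of the graph makes the non-return probabilities vanish, and they
    bound the unit conductance energies of the hitting probabilities.\<close>
  have "AE \<omega> in M. \<forall>\<epsilon>>0. \<exists>n. P.path_energy (U.hit a n) \<omega> < ennreal \<epsilon>" if a: "a \<in> V" for a
  proof (rule P.AE_path_energy_small)
    have lim: "(\<lambda>n. avoid U.step a n a) \<longlonglongrightarrow> 0"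
      using \<open>recurrent_graph V E\<close> a
      unfolding recurrent_graph_def recurrent_network_def AE_return_iff_avoid by blast
    let ?d = "\<lambda>n. dirichlet E (\<lambda>_. 1) {x. U.hit a n x \<noteq> 0} (U.hit a n) (U.hit a n)"
    have "(\<lambda>n. 2 * (U.total a * avoid U.step a (Suc n) a)) \<longlonglongrightarrow> 2 * (U.total a * 0)"
      by (intro tendsto_intros LIMSEQ_Suc[OF lim])
    then have up: "(\<lambda>n. 2 * (U.total a * avoid U.step a (Suc n) a)) \<longlonglongrightarrow> 0"
      by (simp only: mult_zero_right)
    show "?d \<longlonglongrightarrow> 0"
    proof (rule real_tendsto_sandwich[OF _ _ tendsto_const up])
      show "\<forall>\<^sub>F n in sequentially. 0 \<le> ?d n"
        by (intro always_eventually allI U.dirichlet_nonneg)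
      show "\<forall>\<^sub>F n in sequentially. ?d n \<le> 2 * (U.total a * avoid U.step a (Suc n) a)"
        by (intro always_eventually allI U.dirichlet_hit_le U.finite_support_hit order_refl)
    qed
  qed (rule U.finite_support_hit)
  \<comment> \<open>Countability of \<open>V\<close> gives one null set for all starting
    vertices.\<close>
  then have "AE \<omega> in M. \<forall>a\<in>V. \<forall>\<epsilon>>0. \<exists>n. P.path_energy (U.hit a n) \<omega> < ennreal \<epsilon>"
    using V by (subst AE_ball_countable) auto
  moreover have "AE \<omega> in M. \<forall>a\<in>V. finite (P.cluster \<omega> a)"
    using V P.AE_finite_cluster by (subst AE_ball_countable) auto
  moreover note AE_space
  ultimately show ?thesis
  proof eventually_elim
    case (elim \<omega>)
    have fin: "finite (P.cluster \<omega> x)" for x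
      using elim(2) P.cluster_outside by (cases "x \<in> V") auto
    interpret N: electrical_network V E "\<lambda>e. C e \<omega>"
      by unfold_locales (use assms(9) elim(3) in auto)
    show "recurrent_network V E (\<lambda>e. C e \<omega>)"
      unfolding recurrent_network_def AE_return_iff_avoid
    proof (intro ballI N.avoid_tendsto_0)
      fix a and \<epsilon> :: real
      assume a: "a \<in> V" and \<epsilon>: "0 < \<epsilon>"
      \<comment> \<open>Chosen so that \<open>(L + 1) * (2 * \<delta>) = \<epsilon>\<close>;
        \<open>L + 1\<close> in place of \<open>L\<close> avoids dividing by 0.\<close>
      define \<delta> where "\<delta> = \<epsilon> / (2 * (real L + 1))"
      have "0 < \<delta>"
        using \<epsilon> by (simp add: \<delta>_def)
      then obtain n where n: "P.path_energy (U.hit a n) \<omega> < ennreal \<delta>"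
        using elim(1) a by blast
      define g where "g = P.cluster_max (U.hit a n) \<omega>"
      let ?F = "{x. g x \<noteq> 0}"
      have less: "dirichlet E (\<lambda>_. 1) ?F g g < 2 * \<delta>"
        unfolding g_def
        by (rule P.dirichlet_cluster_max_less[OF elim(3) fin U.finite_support_hit n])
      have "dirichlet E (\<lambda>e. C e \<omega>) ?F g g \<le> real L * dirichlet E (\<lambda>_. 1) ?F g g"
        unfolding dirichlet_def sum_distrib_left
      proof (intro sum_mono, clarify)
        fix x y assume "(x, y) \<in> arcs_on E ?F"
        then have "{x, y} \<in> E"
          by (simp add: arcs_on_def)
        \<comment> \<open>Across an edge of \<open>W \<omega>\<close> the cluster, and so
          \<open>g\<close>, is the same at both ends, however large the conductance; other edges
          have conductance at most \<open>L\<close>.\<close>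
        show "C {x, y} \<omega> * (g x - g y) * (g x - g y) \<le> real L * (1 * (g x - g y) * (g x - g y))"
        proof (cases "{x, y} \<in> W \<omega>")
          case True
          then have "g x = g y"
            by (simp add: g_def P.cluster_max_def P.cluster_eq)
          then show ?thesis by simp
        next
          case False
          then have "C {x, y} \<omega> \<le> real L"
            using \<open>{x, y} \<in> E\<close> by (simp add: W_def)
          then show ?thesis
            using mult_right_mono[of "C {x, y} \<omega>" "real L" "(g x - g y) * (g x - g y)"]
            by (simp add: mult.assoc)
        qed
      qed
      also have "\<dots> \<le> (real L + 1) * (2 * \<delta>)"
        using less \<open>0 < \<delta>\<close> by (intro mult_mono) (auto simp: U.dirichlet_nonneg)
      also have "\<dots> = \<epsilon>"
      proof -
        have "real L + 1 \<noteq> 0"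
          by linarith
        then show ?thesis
          unfolding \<delta>_def by (simp add: field_simps)
      qed
      finally have "dirichlet E (\<lambda>e. C e \<omega>) ?F g g \<le> \<epsilon>" .
      moreover have "finite ?F"
        unfolding g_def by (rule P.finite_support_cluster_max[OF fin U.finite_support_hit])
      moreover have "1 \<le> g a"
        using P.cluster_max_ge[OF fin, where f = "U.hit a n" and x = a] by (simp add: g_def U.hit_def)
      ultimately show "\<exists>F g. finite F \<and> (\<forall>x. x \<notin> F \<longrightarrow> g x = 0) \<and> 1 \<le> g a \<and>
          dirichlet E (\<lambda>e. C e \<omega>) F g g \<le> \<epsilon>"
        by (intro exI[of _ ?F] exI[of _ g]) simp
    qed
  qed
qed

end
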